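(* Let $k$ be a field of characteristic $p>0$, let $n\geq1$, and let $\phi$ be an endomorphism of the algebraic group $\mathbb{G}_a^n$ over $k$, regarded as an element of $\mathrm{M}(n,R)$ with $R=k[\tau;a\mapsto a^p,0]$. If $\deg\det\phi<\infty$, then $\ker\phi$ is a closed subgroup scheme of $\mathbb{G}_a^n$ which is finite of rank $p^{\deg\det\phi}$ over $\mathrm{Spec}(k)$.
   Context: $\mathbb{G}_a$ is the additive algebraic group over $k$. Its ring of endomorphisms (as a group scheme over $k$) is the skew polynomial ring $R=k[\tau;a\mapsto a^p,0]$. The elements of $R$ are the expressions $a_0+a_1\tau+\dots+a_m\tau^m$ with $a_i\in k$, with multiplication determined by $\tau a=a^p\tau$ for $a\in k$; here $a\in k$ acts on $\mathbb{G}_a$ by multiplication by $a$ and $\tau$ acts as the $p$-th power Frobenius. There is a canonical isomorphism $\mathrm{End}(\mathbb{G}_a^n)=\mathrm{M}(n,R)$, where $\mathrm{M}(n,S)$ denotes the ring of $n\times n$ matrices over $S$. The ring $R$ is a left principal ideal domain, hence left Ore, with skew field of fractions $Q$ consisting of the fractions $r/s$ (meaning $s^{-1}r$), $r,s\in R$, $s\neq0$. The usual degree in $\tau$ on $R\setminus\{0\}$ extends to $\deg:Q\to\mathbb{Z}\cup\{\infty\}$ by $\deg(r/s)=\deg(r)-\deg(s)$ and $\deg(0)=\infty$. It satisfies $\deg(tu)=\deg(t)+\deg(u)$ and hence factors through $Q^{\mathrm{ab}}:=Q^\times/[Q^\times,Q^\times]\cup\{0\}$. The Dieudonné determinant is the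 multiplicative map $\det:\mathrm{M}(n,Q)\to Q^{\mathrm{ab}}$ that sends non-invertible matrices to $0$, elementary matrices to $1$, and $\mathrm{diag}(1,\dots,1,q)$ with $q\in Q^\times$ to the class of $q$. For $\phi\in\mathrm{M}(n,R)\subset\mathrm{M}(n,Q)$, $\deg\det\phi$ is the degree of $\det(\phi)$. A scheme finite over $\mathrm{Spec}(k)$ has rank $N$ if its coordinate ring has dimension $N$ as a $k$-vector space. *)

theory Defs
  imports
    "HOL-Analysis.Analysis"
    "HOL-Computational_Algebra.Primes"
    "HOL-Library.Poly_Mapping"
    "HOL-Library.Extended"
begin

section \<open>The skew polynomial ring \<open>R = k[\<tau>; a \<mapsto> a\<^sup>p, 0]\<close>\<close>

typedef (overloaded) 'a skew_poly = "{f :: nat \<Rightarrow> 'a::zero. finite {n. f n \<noteq> 0}}"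
  morphisms sp_coeff Abs_skew_poly
  by (rule exI[of _ "\<lambda>_. 0"]) simp

setup_lifting type_definition_skew_poly

lemma sp_eqI: "(\<And>n. sp_coeff f n = sp_coeff g n) \<Longrightarrow> f = g"
  by (simp add: sp_coeff_inject[symmetric] fun_eq_iff)

lemma finite_sp_coeff: "finite {n. sp_coeff f n \<noteq> 0}"
  using sp_coeff[of f] by simp

text \<open>
  The product is determined by \<open>\<tau> a = a\<^sup>p \<tau>\<close>, that is
  \<open>(a \<tau>\<^sup>i) (b \<tau>\<^sup>j) = a b\<^bsup>p\<^sup>i\<^esup> \<tau>\<^bsup>i + j\<^esup>\<close>.
\<close>

instantiation skew_poly :: (field_prime_char) ring_1
begin

lift_definition zero_skew_poly :: "'a skew_poly" is "\<lambda>_. 0" by simp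

lift_definition one_skew_poly :: "'a skew_poly" is "\<lambda>n. if n = 0 then 1 else 0" by simp

lift_definition plus_skew_poly :: "'a skew_poly \<Rightarrow> 'a skew_poly \<Rightarrow> 'a skew_poly"
  is "\<lambda>f g n. f n + g n"
proof -
  fix f g :: "nat \<Rightarrow> 'a"
  assume "finite {n. f n \<noteq> 0}" "finite {n. g n \<noteq> 0}"
  then show "finite {n. f n + g n \<noteq> 0}"
    by (rule_tac finite_subset[of _ "{n. f n \<noteq> 0} \<union> {n. g n \<noteq> 0}"]) auto
qed

lift_definition uminus_skew_poly :: "'a skew_poly \<Rightarrow> 'a skew_poly" is "\<lambda>f n. - f n" by simp

lift_definition minus_skew_poly :: "'a skew_poly \<Rightarrow> 'a skew_poly \<Rightarrow> 'a skew_poly"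
  is "\<lambda>f g n. f n - g n"
proof -
  fix f g :: "nat \<Rightarrow> 'a"
  assume "finite {n. f n \<noteq> 0}" "finite {n. g n \<noteq> 0}"
  then show "finite {n. f n - g n \<noteq> 0}"
    by (rule_tac finite_subset[of _ "{n. f n \<noteq> 0} \<union> {n. g n \<noteq> 0}"]) auto
qed

lift_definition times_skew_poly :: "'a skew_poly \<Rightarrow> 'a skew_poly \<Rightarrow> 'a skew_poly"
  is "\<lambda>f g n. \<Sum>i\<le>n. f i * g (n - i) ^ (CHAR('a) ^ i)"
proof -
  fix f g :: "nat \<Rightarrow> 'a"
  assume fin: "finite {n. f n \<noteq> 0}" "finite {n. g n \<noteq> 0}"
  have "{n. (\<Sum>i\<le>n. f i * g (n - i) ^ (CHAR('a) ^ i)) \<noteq> 0}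
          \<subseteq> (\<lambda>(i, j). i + j) ` ({n. f n \<noteq> 0} \<times> {n. g n \<noteq> 0})"
  proof
    fix n assume "n \<in> {n. (\<Sum>i\<le>n. f i * g (n - i) ^ (CHAR('a) ^ i)) \<noteq> 0}"
    then obtain i where i: "i \<le> n" "f i * g (n - i) ^ (CHAR('a) ^ i) \<noteq> 0"
      by (metis (mono_tags, lifting) atMost_iff mem_Collect_eq sum.neutral)
    then have "f i \<noteq> 0" "g (n - i) \<noteq> 0"
      by (auto simp: power_0_left)
    with i(1) show "n \<in> (\<lambda>(i, j). i + j) ` ({n. f n \<noteq> 0} \<times> {n. g n \<noteq> 0})"
      by (intro image_eqI[of _ _ "(i, n - i)"]) auto
  qed
  then show "finite {n. (\<Sum>i\<le>n. f i * g (n - i) ^ (CHAR('a) ^ i)) \<noteq> 0}"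
    by (rule finite_subset) (use fin in auto)
qed

instance
proof
  fix f g h :: "'a skew_poly"
  have p: "prime CHAR('a)" by simp
  show "f + g + h = f + (g + h)" by transfer (simp add: add.assoc)
  show "f + g = g + f" by transfer (simp add: add.commute)
  show "0 + f = f" by transfer simp
  show "- f + f = 0" by transfer simp
  show "f - g = f + - g" by transfer simp
  show "(0::'a skew_poly) \<noteq> 1" by transfer (auto simp: fun_eq_iff)
  show "1 * f = f"
  proof transfer
    fix f :: "nat \<Rightarrow> 'a"
    show "(\<lambda>n. \<Sum>i\<le>n. (if i = 0 then 1 else 0) * f (n - i) ^ (CHAR('a) ^ i)) = f"
    proof
      fix n
      have "(\<Sum>i\<le>n. (if i = 0 then 1 else 0) * f (n - i) ^ (CHAR('a) ^ i))
              = (\<Sum>i\<in>{0}. f (n - i) ^ (CHAR('a) ^ i))"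
        by (rule sum.mono_neutral_cong_right) auto
      then show "(\<Sum>i\<le>n. (if i = 0 then 1 else 0) * f (n - i) ^ (CHAR('a) ^ i)) = f n"
        by simp
    qed
  qed
  show "f * 1 = f"
  proof transfer
    fix f :: "nat \<Rightarrow> 'a"
    show "(\<lambda>n. \<Sum>i\<le>n. f i * (if n - i = 0 then 1 else 0) ^ (CHAR('a) ^ i)) = f"
    proof
      fix n
      have "(\<Sum>i\<le>n. f i * (if n - i = 0 then 1 else 0) ^ (CHAR('a) ^ i)) = (\<Sum>i\<in>{n}. f i)"
        by (rule sum.mono_neutral_cong_right) (auto simp: power_0_left)
      then show "(\<Sum>i\<le>n. f i * (if n - i = 0 then 1 else 0) ^ (CHAR('a) ^ i)) = f n"
        by simp
    qed
  qed
  show "(f + g) * h = f * h + g * h"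
    by transfer (simp add: distrib_right sum.distrib)
  show "f * (g + h) = f * g + f * h"
    by transfer (simp add: freshmans_dream'[OF p refl] distrib_left sum.distrib)
  show "f * g * h = f * (g * h)"
  proof transfer
    fix f g h :: "nat \<Rightarrow> 'a"
    let ?p = "CHAR('a)"
    show "(\<lambda>n. \<Sum>m\<le>n. (\<Sum>i\<le>m. f i * g (m - i) ^ (?p ^ i)) * h (n - m) ^ (?p ^ m))
        = (\<lambda>n. \<Sum>i\<le>n. f i * (\<Sum>j\<le>n - i. g j * h (n - i - j) ^ (?p ^ j)) ^ (?p ^ i))"
    proof
      fix n
      have pp: "(x ^ (?p ^ j)) ^ (?p ^ i) = x ^ (?p ^ (i + j))" for x :: 'a and i j
        by (metis power_mult power_add mult.commute)
      define F where "F = (\<lambda>i j l. f i * g j ^ (?p ^ i) * h l ^ (?p ^ (i + j)))"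
      have "(\<Sum>m\<le>n. (\<Sum>i\<le>m. f i * g (m - i) ^ (?p ^ i)) * h (n - m) ^ (?p ^ m))
          = (\<Sum>m=0..n. \<Sum>i=0..m. F i (m - i) (n - m))"
        by (auto simp: F_def sum_distrib_right atMost_atLeast0 intro!: sum.cong)
      also have "\<dots> = (\<Sum>j=0..n. \<Sum>i=0..n - j. F j i (n - j - i))"
        by (rule fps_mult_assoc_lemma)
      also have "\<dots> = (\<Sum>i\<le>n. f i * (\<Sum>j\<le>n - i. g j * h (n - i - j) ^ (?p ^ j)) ^ (?p ^ i))"
        unfolding F_def freshmans_dream_sum'[OF p refl] sum_distrib_left atMost_atLeast0
          power_mult_distrib pp mult.assoc ..
      finally show "(\<Sum>m\<le>n. (\<Sum>i\<le>m. f i * g (m - i) ^ (?p ^ i)) * h (n - m) ^ (?p ^ m))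
          = (\<Sum>i\<le>n. f i * (\<Sum>j\<le>n - i. g j * h (n - i - j) ^ (?p ^ j)) ^ (?p ^ i))" .
    qed
  qed
qed

end

text \<open>The degree in \<open>\<tau>\<close>, with the dummy value \<open>0\<close> at the zero polynomial.\<close>

definition sp_degree :: "'a::zero skew_poly \<Rightarrow> nat"
  where "sp_degree f = (LEAST n. \<forall>i>n. sp_coeff f i = 0)"

lemma sp_coeff_eq_0: "sp_degree f < i \<Longrightarrow> sp_coeff f i = 0"
proof -
  obtain N where "\<forall>n\<in>{n. sp_coeff f n \<noteq> 0}. n \<le> N"
    using finite_sp_coeff[of f] unfolding finite_nat_set_iff_bounded_le by blast
  then have "\<forall>i>N. sp_coeff f i = 0"
    by force
  then have "\<forall>i>sp_degree f. sp_coeff f i = 0"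
    unfolding sp_degree_def by (rule LeastI)
  then show "sp_degree f < i \<Longrightarrow> sp_coeff f i = 0" by simp
qed

lemma sp_degree_le: "(\<And>i. n < i \<Longrightarrow> sp_coeff f i = 0) \<Longrightarrow> sp_degree f \<le> n"
  unfolding sp_degree_def by (rule Least_le) simp

lemma sp_lead_coeff_nonzero:
  fixes f :: "'a::field_prime_char skew_poly"
  assumes "f \<noteq> 0"
  shows "sp_coeff f (sp_degree f) \<noteq> 0"
proof
  assume 0: "sp_coeff f (sp_degree f) = 0"
  show False
  proof (cases "sp_degree f")
    case 0
    then have "f = 0"
      using \<open>sp_coeff f (sp_degree f) = 0\<close> sp_coeff_eq_0[of f]
      by (intro sp_eqI) (metis gr0I zero_skew_poly.rep_eq)
    with assms show False by simp
  next
    case (Suc d)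
    have "sp_degree f \<le> d"
      using 0 Suc sp_coeff_eq_0[of f] by (intro sp_degree_le) (metis Suc_lessI)
    with Suc show False by simp
  qed
qed

lemma sp_coeff_mult_top:
  fixes f g :: "'a::field_prime_char skew_poly"
  assumes "sp_degree f \<le> a" "sp_degree g \<le> b"
  shows "sp_coeff (f * g) (a + b) = sp_coeff f a * sp_coeff g b ^ (CHAR('a) ^ a)"
proof -
  have "sp_coeff (f * g) (a + b)
      = (\<Sum>i\<le>a + b. sp_coeff f i * sp_coeff g (a + b - i) ^ (CHAR('a) ^ i))"
    by transfer simp
  also have "\<dots> = (\<Sum>i\<in>{a}. sp_coeff f i * sp_coeff g (a + b - i) ^ (CHAR('a) ^ i))"
  proof (rule sum.mono_neutral_right)
    show "\<forall>i\<in>{..a + b} - {a}. sp_coeff f i * sp_coeff g (a + b - i) ^ (CHAR('a) ^ i) = 0"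
    proof
      fix i assume "i \<in> {..a + b} - {a}"
      then consider "i > a" | "a + b - i > b" by force
      then show "sp_coeff f i * sp_coeff g (a + b - i) ^ (CHAR('a) ^ i) = 0"
      proof cases
        case 1
        then show ?thesis using assms by (simp add: sp_coeff_eq_0)
      next
        case 2
        then show ?thesis using assms by (simp add: sp_coeff_eq_0 power_0_left)
      qed
    qed
  qed auto
  finally show ?thesis by simp
qed

lemma sp_degree_mult_le:
  fixes f g :: "'a::field_prime_char skew_poly"
  shows "sp_degree (f * g) \<le> sp_degree f + sp_degree g"
proof (rule sp_degree_le)
  fix n assume n: "sp_degree f + sp_degree g < n"
  then have "sp_coeff g (n - sp_degree f) = 0"
    by (intro sp_coeff_eq_0) simp
  with n sp_coeff_mult_top[of f "sp_degree f" g "n - sp_degree f"]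
  show "sp_coeff (f * g) n = 0" by (simp add: power_0_left)
qed

instance skew_poly :: (field_prime_char) ring_1_no_zero_divisors
proof
  fix f g :: "'a skew_poly"
  assume "f \<noteq> 0" "g \<noteq> 0"
  then have "sp_coeff (f * g) (sp_degree f + sp_degree g) \<noteq> 0"
    by (simp add: sp_coeff_mult_top sp_lead_coeff_nonzero)
  then show "f * g \<noteq> 0"
    by (metis zero_skew_poly.rep_eq)
qed

lemma sp_degree_mult:
  fixes f g :: "'a::field_prime_char skew_poly"
  assumes "f \<noteq> 0" "g \<noteq> 0"
  shows "sp_degree (f * g) = sp_degree f + sp_degree g"
proof (rule antisym[OF sp_degree_mult_le])
  have "sp_coeff (f * g) (sp_degree f + sp_degree g) \<noteq> 0"
    using assms by (simp add: sp_coeff_mult_top sp_lead_coeff_nonzero)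
  then show "sp_degree f + sp_degree g \<le> sp_degree (f * g)"
    using sp_coeff_eq_0 not_le by blast
qed


section \<open>Fractions over a left Ore domain\<close>

class left_ore_domain = ring_1_no_zero_divisors +
  assumes left_ore: "s \<noteq> 0 \<Longrightarrow> \<exists>a b. a \<noteq> 0 \<and> a * r = b * s"

text \<open>The pair \<open>(r, s)\<close> stands for \<open>r / s = s\<^sup>-\<^sup>1 r\<close>.\<close>

definition lfrac_rel :: "'a::left_ore_domain \<times> 'a \<Rightarrow> 'a \<times> 'a \<Rightarrow> bool" where
  "lfrac_rel x y \<longleftrightarrow> snd x \<noteq> 0 \<and> snd y \<noteq> 0 \<and>
     (\<exists>a b. a \<noteq> 0 \<and> b \<noteq> 0 \<and> a * snd x = b * snd y \<and> a * fst x = b * fst y)"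

lemma left_ore_nz:
  fixes r s :: "'a::left_ore_domain"
  assumes "r \<noteq> 0" "s \<noteq> 0"
  obtains a b where "a \<noteq> 0" "b \<noteq> 0" "a * r = b * s"
  using left_ore[OF assms(2), of r] assms by (metis mult_eq_0_iff)

lemma part_equivp_lfrac_rel: "part_equivp (lfrac_rel :: 'a::left_ore_domain \<times> 'a \<Rightarrow> _)"
proof (rule part_equivpI)
  show "\<exists>x. lfrac_rel x (x :: 'a \<times> 'a)"
    by (rule exI[of _ "(0, 1)"]) (auto simp: lfrac_rel_def intro: exI[of _ 1])
  show "symp (lfrac_rel :: 'a \<times> 'a \<Rightarrow> _)"
  proof (rule sympI)
    fix x y :: "'a \<times> 'a"
    assume "lfrac_rel x y"
    then obtain a b where "snd x \<noteq> 0" "snd y \<noteq> 0" "a \<noteq> 0" "b \<noteq> 0"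
      "b * snd y = a * snd x" "b * fst y = a * fst x"
      unfolding lfrac_rel_def by auto
    then show "lfrac_rel y x"
      unfolding lfrac_rel_def by blast
  qed
  show "transp (lfrac_rel :: 'a \<times> 'a \<Rightarrow> _)"
  proof (rule transpI)
    fix x y z :: "'a \<times> 'a"
    assume "lfrac_rel x y" "lfrac_rel y z"
    then obtain a b c d where
      nz: "snd x \<noteq> 0" "snd z \<noteq> 0" "a \<noteq> 0" "b \<noteq> 0" "c \<noteq> 0" "d \<noteq> 0" and
      eqs: "a * snd x = b * snd y" "a * fst x = b * fst y"
        "c * snd y = d * snd z" "c * fst y = d * fst z"
      unfolding lfrac_rel_def by blast
    obtain u v where uv: "u \<noteq> 0" "v \<noteq> 0" "u * b = v * c"
      using left_ore_nz[OF nz(4,5)] .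
    have "u * a * snd x = v * d * snd z" "u * a * fst x = v * d * fst z"
      using eqs uv(3) by (metis mult.assoc)+
    moreover have "u * a \<noteq> 0" "v * d \<noteq> 0" using nz uv by auto
    ultimately show "lfrac_rel x z" using nz unfolding lfrac_rel_def by blast
  qed
qed

quotient_type (overloaded) 'a lfrac = "'a::left_ore_domain \<times> 'a" / partial: lfrac_rel
  by (rule part_equivp_lfrac_rel)

lift_definition LFrac :: "'a::left_ore_domain \<Rightarrow> 'a \<Rightarrow> 'a lfrac"
  is "\<lambda>r s. if s = 0 then (0, 1) else (r, s)"
  by (auto simp: lfrac_rel_def intro: exI[of _ 1])

lemma LFrac_cases:
  obtains r s where "x = LFrac r s" "s \<noteq> 0"
  by transfer (auto simp: lfrac_rel_def)

lemma LFrac_eq_iff: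
  "s \<noteq> 0 \<Longrightarrow> s' \<noteq> 0 \<Longrightarrow> LFrac r s = LFrac r' s' \<longleftrightarrow>
     (\<exists>a b. a \<noteq> 0 \<and> b \<noteq> 0 \<and> a * s = b * s' \<and> a * r = b * r')"
  by transfer (simp add: lfrac_rel_def)

lemma LFrac_expand: "c \<noteq> 0 \<Longrightarrow> s \<noteq> 0 \<Longrightarrow> LFrac (c * r) (c * s) = LFrac r s"
  by (subst LFrac_eq_iff) (simp, simp, rule exI[of _ 1], rule exI[of _ c], simp)

lemma LFrac_same_denom: "s \<noteq> 0 \<Longrightarrow> LFrac r s = LFrac r' s \<longleftrightarrow> r = r'"
  by (subst LFrac_eq_iff) auto

lemma LFrac_common2:
  fixes x y :: "'a::left_ore_domain lfrac"
  obtains r r' s where "s \<noteq> 0" "x = LFrac r s" "y = LFrac r' s"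
proof -
  obtain a s where x: "x = LFrac a s" "s \<noteq> 0" by (rule LFrac_cases)
  obtain b t where y: "y = LFrac b t" "t \<noteq> 0" by (rule LFrac_cases)
  obtain c d where cd: "c \<noteq> 0" "d \<noteq> 0" "c * s = d * t" using left_ore_nz[OF x(2) y(2)] .
  have "x = LFrac (c * a) (c * s)"
    using x cd(1) by (simp add: LFrac_expand)
  moreover have "y = LFrac (d * b) (c * s)"
    using y cd by (simp add: LFrac_expand)
  moreover have "c * s \<noteq> 0" using x cd(1) by simp
  ultimately show thesis using that by blast
qed

lemma LFrac_common3:
  fixes x y z :: "'a::left_ore_domain lfrac"
  obtains r r' r'' s where "s \<noteq> 0" "x = LFrac r s" "y = LFrac r' s" "z = LFrac r'' s"
proof -
  obtain a b s where xy: "s \<noteq> 0" "x = LFrac a s" "y = LFrac b s" by (rule LFrac_common2)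
  obtain e t where z: "z = LFrac e t" "t \<noteq> 0" by (rule LFrac_cases)
  obtain c d where cd: "c \<noteq> 0" "d \<noteq> 0" "c * s = d * t" using left_ore_nz[OF xy(1) z(2)] .
  have "x = LFrac (c * a) (c * s)" "y = LFrac (c * b) (c * s)"
    using xy cd(1) by (simp_all add: LFrac_expand)
  moreover have "z = LFrac (d * e) (c * s)"
    using z cd by (simp add: LFrac_expand)
  moreover have "c * s \<noteq> 0" using xy cd(1) by simp
  ultimately show thesis using that by blast
qed

instantiation lfrac :: (left_ore_domain) "{zero, one, plus, uminus, minus, times, inverse}"
begin

definition "0 = LFrac 0 1"

definition "1 = LFrac 1 1"

text \<open>\<open>s\<^sup>-\<^sup>1 r + s\<^sup>-\<^sup>1 r' = s\<^sup>-\<^sup>1 (r + r')\<close>\<close>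

definition "x + y = (THE z :: 'a lfrac. \<exists>r r' s. s \<noteq> 0 \<and>
  x = LFrac r s \<and> y = LFrac r' s \<and> z = LFrac (r + r') s)"

lift_definition uminus_lfrac :: "'a lfrac \<Rightarrow> 'a lfrac" is "\<lambda>(r, s). (- r, s)"
  by (auto simp: lfrac_rel_def)

definition "x - y = x + - (y :: 'a lfrac)"

text \<open>\<open>(s\<^sup>-\<^sup>1 b t) (t\<^sup>-\<^sup>1 u) = s\<^sup>-\<^sup>1 b u\<close>\<close>

definition "x * y = (THE z :: 'a lfrac. \<exists>b s t u. s \<noteq> 0 \<and> t \<noteq> 0 \<and>
  x = LFrac (b * t) s \<and> y = LFrac u t \<and> z = LFrac (b * u) s)"

lift_definition inverse_lfrac :: "'a lfrac \<Rightarrow> 'a lfrac"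
  is "\<lambda>(r, s). if r = 0 then (0, 1) else (s, r)"
proof -
  fix x y :: "'a \<times> 'a"
  assume "lfrac_rel x y"
  then obtain a b where nz: "snd x \<noteq> 0" "snd y \<noteq> 0" "a \<noteq> 0" "b \<noteq> 0" and
    eqs: "a * snd x = b * snd y" "a * fst x = b * fst y"
    unfolding lfrac_rel_def by blast
  have 0: "fst x = 0 \<longleftrightarrow> fst y = 0" using eqs(2) nz by (metis mult_eq_0_iff)
  show "lfrac_rel (case x of (r, s) \<Rightarrow> if r = 0 then (0, 1) else (s, r))
                  (case y of (r, s) \<Rightarrow> if r = 0 then (0, 1) else (s, r))"
  proof (cases "fst x = 0")
    case True
    with 0 show ?thesis
      by (cases x, cases y) (simp add: lfrac_rel_def, rule exI[of _ 1], simp)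
  next
    case False
    with 0 nz eqs show ?thesis
      by (cases x, cases y) (simp add: lfrac_rel_def, blast)
  qed
qed

definition "x div y = x * inverse (y :: 'a lfrac)"

instance ..

end

lemma LFrac_add:
  fixes s :: "'a::left_ore_domain"
  assumes s: "s \<noteq> 0"
  shows "LFrac r s + LFrac r' s = LFrac (r + r') s"
  unfolding plus_lfrac_def
proof (rule the_equality)
  show "\<exists>q q' t. t \<noteq> 0 \<and> LFrac r s = LFrac q t \<and> LFrac r' s = LFrac q' t \<and>
          LFrac (r + r') s = LFrac (q + q') t"
    using s by blast
next
  fix z
  assume "\<exists>q q' t. t \<noteq> 0 \<and> LFrac r s = LFrac q t \<and> LFrac r' s = LFrac q' t \<and> z = LFrac (q + q') t"
  then obtain q q' t where t: "t \<noteq> 0" and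
    eqs: "LFrac r s = LFrac q t" "LFrac r' s = LFrac q' t" "z = LFrac (q + q') t" by blast
  obtain a b where ab: "a \<noteq> 0" "b \<noteq> 0" "a * s = b * t" using left_ore_nz[OF s t] .
  have as: "a * s \<noteq> 0" using ab(1) s by simp
  have "LFrac (a * r) (a * s) = LFrac (b * q) (a * s)"
       "LFrac (a * r') (a * s) = LFrac (b * q') (a * s)"
    using eqs s t ab by (metis LFrac_expand)+
  then have "a * r = b * q" "a * r' = b * q'"
    using as by (simp_all add: LFrac_same_denom)
  then have "a * (r + r') = b * (q + q')" by (simp add: distrib_left)
  then show "z = LFrac (r + r') s"
    using eqs(3) ab s t by (metis LFrac_eq_iff)
qed

lemma LFrac_mult:
  fixes s t :: "'a::left_ore_domain"
  assumes s: "s \<noteq> 0" and t: "t \<noteq> 0"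
  shows "LFrac (b * t) s * LFrac u t = LFrac (b * u) s"
  unfolding times_lfrac_def
proof (rule the_equality)
  show "\<exists>b' s' t' u'. s' \<noteq> 0 \<and> t' \<noteq> 0 \<and> LFrac (b * t) s = LFrac (b' * t') s' \<and>
          LFrac u t = LFrac u' t' \<and> LFrac (b * u) s = LFrac (b' * u') s'"
    using s t by blast
next
  fix z
  assume "\<exists>b' s' t' u'. s' \<noteq> 0 \<and> t' \<noteq> 0 \<and> LFrac (b * t) s = LFrac (b' * t') s' \<and>
          LFrac u t = LFrac u' t' \<and> z = LFrac (b' * u') s'"
  then obtain b' s' t' u' where nz: "s' \<noteq> 0" "t' \<noteq> 0" and
    eqs: "LFrac (b * t) s = LFrac (b' * t') s'" "LFrac u t = LFrac u' t'" "z = LFrac (b' * u') s'"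
    by blast
  obtain c d where cd: "c \<noteq> 0" "d \<noteq> 0" "c * t = d * t'" "c * u = d * u'"
    using eqs(2) LFrac_eq_iff[OF t nz(2)] by blast
  obtain e f where ef: "e \<noteq> 0" "f \<noteq> 0" "e * s = f * s'" "e * (b * t) = f * (b' * t')"
    using eqs(1) LFrac_eq_iff[OF s nz(1)] by blast
  obtain x y where xy: "x \<noteq> 0" "x * (e * b) = y * c"
    using left_ore[OF cd(1)] by blast
  have "x * f * b' * t' = y * d * t'"
    using xy(2) ef(4) cd(3) by (metis mult.assoc)
  then have xfb: "x * f * b' = y * d" using nz by simp
  have "x * (e * (b * u)) = x * (f * (b' * u'))"
    using xfb xy(2) cd(4) by (metis mult.assoc)
  then have "e * (b * u) = f * (b' * u')" using xy by simp
  then show "z = LFrac (b * u) s"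
    using eqs(3) ef s nz by (metis LFrac_eq_iff)
qed

lemma LFrac_uminus: "s \<noteq> 0 \<Longrightarrow> - LFrac r s = LFrac (- r) s"
  by transfer (auto simp: lfrac_rel_def)

lemma LFrac_inverse: "r \<noteq> 0 \<Longrightarrow> s \<noteq> 0 \<Longrightarrow> inverse (LFrac r s) = LFrac s r"
  by transfer (auto simp: lfrac_rel_def)

lemma LFrac_zero_num: "s \<noteq> 0 \<Longrightarrow> LFrac 0 s = 0"
  unfolding zero_lfrac_def by (subst LFrac_eq_iff) (auto intro!: exI[of _ 1] exI[of _ s])

lemma LFrac_eq_0_iff: "s \<noteq> 0 \<Longrightarrow> LFrac r s = 0 \<longleftrightarrow> r = 0"
  by (metis LFrac_same_denom LFrac_zero_num)

lemma LFrac_self: "s \<noteq> 0 \<Longrightarrow> LFrac s s = 1"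
  unfolding one_lfrac_def by (subst LFrac_eq_iff) (auto intro!: exI[of _ 1] exI[of _ s])

lemma LFrac_chain:
  fixes y :: "'a::left_ore_domain lfrac"
  assumes "s \<noteq> 0"
  obtains a b t u where "a \<noteq> 0" "t \<noteq> 0" "y = LFrac u t" "a * r = b * t"
    "LFrac r s = LFrac (b * t) (a * s)"
proof -
  obtain u t where y: "y = LFrac u t" "t \<noteq> 0" by (rule LFrac_cases)
  obtain a b where ab: "a \<noteq> 0" "a * r = b * t" using left_ore[OF y(2)] by blast
  with that[of a t u b] y assms show thesis by (metis LFrac_expand)
qed

instance lfrac :: (left_ore_domain) division_ring
proof
  fix x y z :: "'a lfrac"
  show "x + y + z = x + (y + z)"
    by (rule LFrac_common3[of x y z]) (simp add: LFrac_add add.assoc)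
  show "x + y = y + x"
    by (rule LFrac_common2[of x y]) (simp add: LFrac_add add.commute)
  show "0 + x = x"
  proof (rule LFrac_cases[of x])
    fix r s assume *: "x = LFrac r s" "s \<noteq> 0"
    then show ?thesis by (simp add: LFrac_zero_num[of s, symmetric] LFrac_add)
  qed
  show "- x + x = 0"
    by (rule LFrac_cases[of x]) (simp add: LFrac_uminus LFrac_add LFrac_zero_num)
  show "x - y = x + - y" by (simp add: minus_lfrac_def)
  show "x div y = x * inverse y" by (simp add: divide_lfrac_def)
  show "(0::'a lfrac) \<noteq> 1"
    by (simp add: zero_lfrac_def one_lfrac_def LFrac_same_denom)
  show "inverse (0::'a lfrac) = 0"
    unfolding zero_lfrac_def by transfer (auto simp: lfrac_rel_def intro: exI[of _ 1])
  show "1 * x = x"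
  proof (rule LFrac_cases[of x])
    fix r s assume *: "x = LFrac r s" "s \<noteq> 0"
    then show ?thesis
      using LFrac_mult[of s s 1 r] by (simp add: LFrac_self)
  qed
  show "x * 1 = x"
  proof (rule LFrac_cases[of x])
    fix r s assume *: "x = LFrac r s" "s \<noteq> 0"
    then show ?thesis
      using LFrac_mult[of s 1 r 1] by (simp add: one_lfrac_def)
  qed
  show "x * y * z = x * (y * z)"
  proof -
    obtain r0 s0 where x0: "x = LFrac r0 s0" "s0 \<noteq> 0" by (rule LFrac_cases)
    obtain a b t0 u0 where 1: "a \<noteq> 0" "t0 \<noteq> 0" "y = LFrac u0 t0"
      "LFrac r0 s0 = LFrac (b * t0) (a * s0)"
      by (rule LFrac_chain[OF x0(2), where y = y and r = r0])
    obtain c d v w where 2: "c \<noteq> 0" "v \<noteq> 0" "z = LFrac w v" "c * u0 = d * v"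
      "LFrac u0 t0 = LFrac (d * v) (c * t0)"
      by (rule LFrac_chain[OF 1(2), where y = z and r = u0])
    have ct: "c * t0 \<noteq> 0" and as0: "a * s0 \<noteq> 0" using 1 2 x0 by auto
    have "x = LFrac (b * t0) (a * s0)" using x0 1 by simp
    then obtain e f where 3: "e \<noteq> 0" "e * b = f * c"
      using left_ore[OF 2(1), of b] by blast
    have x: "x = LFrac (f * (c * t0)) (e * (a * s0))"
      using \<open>x = LFrac (b * t0) (a * s0)\<close> 3 as0 by (metis LFrac_expand mult.assoc)
    have y: "y = LFrac (d * v) (c * t0)" using 1 2 by simp
    have es: "e * (a * s0) \<noteq> 0" using 3 as0 by simp
    have "x * y = LFrac (f * d * v) (e * (a * s0))"
      using x y LFrac_mult[OF es ct, of f "d * v"] by (simp add: mult.assoc)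
    then have "x * y * z = LFrac (f * d * w) (e * (a * s0))"
      using 2 LFrac_mult[OF es 2(2), of "f * d" w] by simp
    moreover have "y * z = LFrac (d * w) (c * t0)"
      using y 2 LFrac_mult[OF ct 2(2), of d w] by simp
    then have "x * (y * z) = LFrac (f * (d * w)) (e * (a * s0))"
      using x LFrac_mult[OF es ct, of f "d * w"] by simp
    ultimately show ?thesis by (simp add: mult.assoc)
  qed
  show "x * (y + z) = x * y + x * z"
  proof -
    obtain r0 s0 where x0: "x = LFrac r0 s0" "s0 \<noteq> 0" by (rule LFrac_cases)
    obtain u v t where yz: "t \<noteq> 0" "y = LFrac u t" "z = LFrac v t" by (rule LFrac_common2)
    obtain a b where ab: "a \<noteq> 0" "a * r0 = b * t" using left_ore[OF yz(1)] by blast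
    have as: "a * s0 \<noteq> 0" using ab x0 by simp
    have x: "x = LFrac (b * t) (a * s0)" using x0 ab by (metis LFrac_expand)
    show ?thesis
      unfolding x yz LFrac_add[OF yz(1)] LFrac_mult[OF as yz(1)] LFrac_add[OF as]
      by (simp add: distrib_left)
  qed
  show "(x + y) * z = x * z + y * z"
  proof -
    obtain r r' s where xy: "s \<noteq> 0" "x = LFrac r s" "y = LFrac r' s" by (rule LFrac_common2)
    obtain u t where z: "z = LFrac u t" "t \<noteq> 0" by (rule LFrac_cases)
    obtain a b where ab: "a \<noteq> 0" "a * r = b * t" using left_ore[OF z(2)] by blast
    obtain c d where cd: "c \<noteq> 0" "c * (a * r') = d * t" using left_ore[OF z(2)] by blast
    have s': "c * a * s \<noteq> 0" using ab cd xy by simp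
    have "x = LFrac (c * a * r) (c * a * s)" "y = LFrac (c * a * r') (c * a * s)"
      using xy ab cd LFrac_expand[of "c * a"] by simp_all
    then have x: "x = LFrac (c * b * t) (c * a * s)" and y: "y = LFrac (d * t) (c * a * s)"
      using ab cd by (simp_all add: mult.assoc)
    show ?thesis
      unfolding x y z(1) LFrac_add[OF s'] LFrac_mult[OF s' z(2)] distrib_right[symmetric] ..
  qed
  show "inverse x * x = 1" if "x \<noteq> 0"
  proof -
    obtain r s where x: "x = LFrac r s" "s \<noteq> 0" by (rule LFrac_cases)
    have "r \<noteq> 0" using that x by (auto simp: LFrac_zero_num)
    with x show ?thesis
      using LFrac_mult[of r s 1 r] by (simp add: LFrac_inverse LFrac_self)
  qed
  show "x * inverse x = 1" if "x \<noteq> 0"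
  proof -
    obtain r s where x: "x = LFrac r s" "s \<noteq> 0" by (rule LFrac_cases)
    have "r \<noteq> 0" using that x by (auto simp: LFrac_zero_num)
    with x show ?thesis
      using LFrac_mult[of s r 1 s] by (simp add: LFrac_inverse LFrac_self)
  qed
qed

definition to_lfrac :: "'a::left_ore_domain \<Rightarrow> 'a lfrac"
  where "to_lfrac r = LFrac r 1"


section \<open>The skew field \<open>Q\<close> of fractions of \<open>R\<close> and its degree\<close>

lift_definition sp_monom :: "'a::zero \<Rightarrow> nat \<Rightarrow> 'a skew_poly"
  is "\<lambda>a m n. if n = m then a else 0"
  by simp

lemma sp_degree_monom_le: "sp_degree (sp_monom a m) \<le> m"
  by (rule sp_degree_le) (simp add: sp_monom.rep_eq)

lemma sp_division:
  fixes f g :: "'a::field_prime_char skew_poly"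
  assumes g: "g \<noteq> 0"
  shows "\<exists>q r. f = q * g + r \<and> (r = 0 \<or> sp_degree r < sp_degree g)"
proof (induction "sp_degree f" arbitrary: f rule: less_induct)
  case less
  show ?case
  proof (cases "f = 0 \<or> sp_degree f < sp_degree g")
    case True
    then show ?thesis by (intro exI[of _ 0] exI[of _ f]) auto
  next
    case False
    then have f: "f \<noteq> 0" and le: "sp_degree g \<le> sp_degree f" by auto
    define m where "m = sp_degree f - sp_degree g"
    define c where
      "c = sp_coeff f (sp_degree f) / sp_coeff g (sp_degree g) ^ (CHAR('a) ^ m)"
    define h where "h = f - sp_monom c m * g"
    have df: "sp_degree f = m + sp_degree g" using le by (simp add: m_def)
    have deg: "sp_degree (sp_monom c m * g) \<le> sp_degree f"
      using sp_degree_mult_le[of "sp_monom c m" g] sp_degree_monom_le[of c m] df by simp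
    have "sp_coeff (sp_monom c m * g) (sp_degree f) = sp_coeff f (sp_degree f)"
      unfolding df using sp_coeff_mult_top[OF sp_degree_monom_le order_refl, of c m g]
        sp_lead_coeff_nonzero[OF g] df by (simp add: sp_monom.rep_eq c_def)
    then have "sp_coeff h (sp_degree f) = 0"
      by (simp add: h_def minus_skew_poly.rep_eq)
    moreover have "sp_coeff h i = 0" if "i > sp_degree f" for i
      using that deg by (simp add: h_def minus_skew_poly.rep_eq sp_coeff_eq_0)
    ultimately have h0: "sp_coeff h i = 0" if "i \<ge> sp_degree f" for i
      using that le_neq_implies_less by blast
    have "h = 0 \<or> sp_degree h < sp_degree f"
      using h0 sp_lead_coeff_nonzero[of h] not_le by blast
    then obtain q r where qr: "h = q * g + r" "r = 0 \<or> sp_degree r < sp_degree g"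
    proof
      assume "h = 0"
      with that[of 0 0] show thesis by simp
    next
      assume "sp_degree h < sp_degree f"
      with less that show thesis by blast
    qed
    have "f = (q + sp_monom c m) * g + r"
      using qr(1) by (simp add: h_def distrib_right algebra_simps)
    with qr(2) show ?thesis by blast
  qed
qed

instance skew_poly :: (field_prime_char) left_ore_domain
proof
  fix s r :: "'a skew_poly"
  assume "s \<noteq> 0"
  then show "\<exists>a b. a \<noteq> 0 \<and> a * r = b * s"
  proof (induction "sp_degree s" arbitrary: r s rule: less_induct)
    case less
    obtain q h where qh: "r = q * s + h" "h = 0 \<or> sp_degree h < sp_degree s"
      using sp_division[OF less.prems] by blast
    show ?case
    proof (cases "h = 0")
      case True
      with qh show ?thesis by (intro exI[of _ 1] exI[of _ q]) simp
    next
      case False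
      with less.hyps[of h s] qh obtain a b where ab: "a \<noteq> 0" "a * s = b * h" by blast
      have "b \<noteq> 0" using ab less.prems by (metis mult_eq_0_iff)
      moreover have "b * r = (b * q + a) * s"
        by (simp add: qh(1) distrib_left distrib_right mult.assoc ab(2))
      ultimately show ?thesis by blast
    qed
  qed
qed

text \<open>\<open>deg : Q \<rightarrow> \<int> \<union> {\<infinity>}\<close>; the value \<open>Minf\<close> of the type \<open>int extended\<close> is not taken.\<close>

lift_definition lfrac_deg :: "'k::field_prime_char skew_poly lfrac \<Rightarrow> int extended"
  is "\<lambda>(r, s). if r = 0 then Pinf else Fin (int (sp_degree r) - int (sp_degree s))"
proof -
  fix x y :: "'k skew_poly \<times> 'k skew_poly"
  assume "lfrac_rel x y"
  then obtain a b where nz: "snd x \<noteq> 0" "snd y \<noteq> 0" "a \<noteq> 0" "b \<noteq> 0" and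
    eqs: "a * snd x = b * snd y" "a * fst x = b * fst y"
    unfolding lfrac_rel_def by blast
  have 0: "fst x = 0 \<longleftrightarrow> fst y = 0" using eqs(2) nz by (metis mult_eq_0_iff)
  have "sp_degree a + sp_degree (snd x) = sp_degree b + sp_degree (snd y)"
    using nz eqs(1) by (metis sp_degree_mult)
  moreover have "sp_degree a + sp_degree (fst x) = sp_degree b + sp_degree (fst y)" if "fst x \<noteq> 0"
    using nz eqs(2) that 0 by (metis sp_degree_mult)
  ultimately show "(case x of (r, s) \<Rightarrow>
      if r = 0 then Pinf else Fin (int (sp_degree r) - int (sp_degree s))) =
    (case y of (r, s) \<Rightarrow> if r = 0 then Pinf else Fin (int (sp_degree r) - int (sp_degree s)))"
    using 0 by (auto split: prod.splits)
qed

lemma lfrac_deg_LFrac: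
  "s \<noteq> 0 \<Longrightarrow> lfrac_deg (LFrac r s) =
     (if r = 0 then Pinf else Fin (int (sp_degree r) - int (sp_degree s)))"
  by transfer simp

lemma lfrac_deg_eq_Pinf_iff: "lfrac_deg x = Pinf \<longleftrightarrow> x = 0"
  by (rule LFrac_cases[of x]) (simp add: lfrac_deg_LFrac LFrac_eq_0_iff)

lemma lfrac_deg_nonzero: "x \<noteq> 0 \<Longrightarrow> \<exists>d. lfrac_deg x = Fin d"
  by (rule LFrac_cases[of x]) (auto simp: lfrac_deg_LFrac LFrac_zero_num)

lemma lfrac_deg_one: "lfrac_deg 1 = Fin 0"
  unfolding one_lfrac_def by (simp add: lfrac_deg_LFrac)

lemma lfrac_deg_mult: "lfrac_deg (x * y) = lfrac_deg x + lfrac_deg y"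
proof (cases "x = 0 \<or> y = 0")
  case True
  moreover have "Pinf + lfrac_deg z = Pinf" "lfrac_deg z + Pinf = Pinf" for z :: "'a skew_poly lfrac"
    using lfrac_deg_nonzero[of z] lfrac_deg_eq_Pinf_iff[of z] by (cases "z = 0"; auto)+
  moreover have "lfrac_deg 0 = (Pinf :: int extended)"
    by (simp add: lfrac_deg_eq_Pinf_iff)
  ultimately show ?thesis by (metis mult_zero_left mult_zero_right)
next
  case False
  obtain r s where x: "x = LFrac r s" "s \<noteq> 0" by (rule LFrac_cases)
  obtain a b t u where 1: "a \<noteq> 0" "t \<noteq> 0" "y = LFrac u t"
    "LFrac r s = LFrac (b * t) (a * s)"
    by (rule LFrac_chain[OF x(2), where y = y and r = r])
  have as: "a * s \<noteq> 0" using 1 x by simp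
  have x': "x = LFrac (b * t) (a * s)" using x 1 by simp
  have "b \<noteq> 0" "u \<noteq> 0"
    using False x' 1 as by (auto simp: LFrac_zero_num)
  moreover have "x * y = LFrac (b * u) (a * s)"
    unfolding x' 1(3) by (rule LFrac_mult[OF as 1(2)])
  ultimately show ?thesis
    using as 1 x' by (simp add: lfrac_deg_LFrac sp_degree_mult)
qed


section \<open>\<open>Q\<^sup>a\<^sup>b = Q\<^sup>\<times>/[Q\<^sup>\<times>, Q\<^sup>\<times>] \<union> {0}\<close> and the Dieudonne determinant\<close>

inductive_set commutator_subgroup :: "'q::division_ring set" where
  one: "1 \<in> commutator_subgroup"
| commutator: "a \<noteq> 0 \<Longrightarrow> b \<noteq> 0 \<Longrightarrow> a * b * inverse a * inverse b \<in> commutator_subgroup"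
| mult: "x \<in> commutator_subgroup \<Longrightarrow> y \<in> commutator_subgroup \<Longrightarrow> x * y \<in> commutator_subgroup"
| inv: "x \<in> commutator_subgroup \<Longrightarrow> inverse x \<in> commutator_subgroup"

definition ab_rel :: "'q::division_ring \<Rightarrow> 'q \<Rightarrow> bool" where
  "ab_rel x y \<longleftrightarrow> x = 0 \<and> y = 0 \<or>
     x \<noteq> 0 \<and> y \<noteq> 0 \<and> x * inverse y \<in> commutator_subgroup"

lemma commutator_subgroup_nonzero: "x \<in> commutator_subgroup \<Longrightarrow> x \<noteq> 0"
  by (induction rule: commutator_subgroup.induct) auto

lemma commutator_subgroup_conj:
  assumes "x \<in> commutator_subgroup" "a \<noteq> 0"
  shows "a * x * inverse a \<in> commutator_subgroup"
proof -
  have "x \<noteq> 0" by (rule commutator_subgroup_nonzero[OF assms(1)])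
  then have "a * x * inverse a = (a * x * inverse a * inverse x) * x"
    by (simp add: mult.assoc)
  with \<open>x \<noteq> 0\<close> assms show ?thesis
    by (metis commutator_subgroup.commutator commutator_subgroup.mult)
qed

lemma equivp_ab_rel: "equivp ab_rel"
proof (rule equivpI)
  show "reflp (ab_rel :: 'a \<Rightarrow> _)"
    by (rule reflpI) (auto simp: ab_rel_def commutator_subgroup.one)
  show "symp (ab_rel :: 'a \<Rightarrow> _)"
  proof (rule sympI)
    fix x y :: 'a assume "ab_rel x y"
    moreover have "inverse (x * inverse y) = y * inverse x" if "x \<noteq> 0" "y \<noteq> 0"
      using that by (simp add: nonzero_inverse_mult_distrib)
    ultimately show "ab_rel y x"
      unfolding ab_rel_def by (metis commutator_subgroup.inv)
  qed
  show "transp (ab_rel :: 'a \<Rightarrow> _)"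
  proof (rule transpI)
    fix x y z :: 'a assume "ab_rel x y" "ab_rel y z"
    moreover have "(x * inverse y) * (y * inverse z) = x * inverse z" if "y \<noteq> 0"
      using that by (metis left_inverse mult.assoc mult_1_left)
    ultimately show "ab_rel x z"
      unfolding ab_rel_def by (metis commutator_subgroup.mult)
  qed
qed

quotient_type (overloaded) 'q ab = "'q::division_ring" / ab_rel morphisms rep_ab ab_class
  by (rule equivp_ab_rel)

instantiation ab :: (division_ring) "{comm_monoid_mult, mult_zero}"
begin

lift_definition zero_ab :: "'a ab" is 0 .

lift_definition one_ab :: "'a ab" is 1 .

lift_definition times_ab :: "'a ab \<Rightarrow> 'a ab \<Rightarrow> 'a ab" is "(*)"
proof -
  fix x y x' y' :: 'a
  assume *: "ab_rel x y" "ab_rel x' y'"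
  show "ab_rel (x * x') (y * y')"
  proof (cases "x = 0 \<or> x' = 0")
    case True
    with * show ?thesis by (auto simp: ab_rel_def)
  next
    case False
    with * have nz: "x \<noteq> 0" "y \<noteq> 0" "x' \<noteq> 0" "y' \<noteq> 0"
      and c: "x * inverse y \<in> commutator_subgroup" "x' * inverse y' \<in> commutator_subgroup"
      by (auto simp: ab_rel_def)
    have "x * (x' * inverse y') * inverse x * (x * inverse y)
        = x * (x' * inverse y') * ((inverse x * x) * inverse y)"
      by (simp only: mult.assoc)
    also have "\<dots> = x * x' * inverse (y * y')"
      using nz by (simp add: nonzero_inverse_mult_distrib mult.assoc)
    finally show ?thesis
      using nz c by (metis ab_rel_def commutator_subgroup.mult commutator_subgroup_conj mult_eq_0_iff)
  qed
qed

instance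
proof
  fix x y z :: "'a ab"
  show "x * y * z = x * (y * z)"
    by transfer (simp add: mult.assoc equivp_reflp[OF equivp_ab_rel])
  show "1 * x = x"
    by transfer (simp add: equivp_reflp[OF equivp_ab_rel])
  show "0 * x = 0" "x * 0 = 0"
    by (transfer, simp add: ab_rel_def)+
  show "x * y = y * x"
  proof transfer
    fix x y :: 'a
    show "ab_rel (x * y) (y * x)"
      using commutator_subgroup.commutator[of x y]
      by (cases "x = 0 \<or> y = 0") (auto simp: ab_rel_def nonzero_inverse_mult_distrib mult.assoc)
  qed
qed

end

lemma lfrac_deg_inverse:
  assumes "x \<noteq> 0" "lfrac_deg x = Fin d"
  shows "lfrac_deg (inverse x) = Fin (- d)"
proof -
  have "lfrac_deg x + lfrac_deg (inverse x) = Fin 0"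
    using assms(1) by (metis lfrac_deg_mult lfrac_deg_one right_inverse)
  moreover obtain e where "lfrac_deg (inverse x) = Fin e"
    using lfrac_deg_nonzero assms(1) by (metis nonzero_imp_inverse_nonzero)
  ultimately show ?thesis using assms(2) by simp
qed

lemma lfrac_deg_commutator_subgroup:
  assumes "x \<in> commutator_subgroup"
  shows "lfrac_deg x = Fin 0"
  using assms
proof (induction rule: commutator_subgroup.induct)
  case one
  show ?case by (rule lfrac_deg_one)
next
  case (commutator a b)
  then obtain d e where "lfrac_deg a = Fin d" "lfrac_deg b = Fin e"
    using lfrac_deg_nonzero by blast
  with commutator show ?case by (simp add: lfrac_deg_mult lfrac_deg_inverse)
next
  case (mult x y)
  then show ?case by (simp add: lfrac_deg_mult)
next
  case (inv x)
  then show ?case using lfrac_deg_inverse[of x 0] commutator_subgroup_nonzero[of x] by simp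
qed

lift_definition ab_deg :: "'k::field_prime_char skew_poly lfrac ab \<Rightarrow> int extended" is lfrac_deg
proof -
  fix x y :: "'k skew_poly lfrac"
  assume *: "ab_rel x y"
  show "lfrac_deg x = lfrac_deg y"
  proof (cases "x = 0")
    case True
    with * show ?thesis by (simp add: ab_rel_def)
  next
    case False
    with * have nz: "x \<noteq> 0" "y \<noteq> 0" and c: "x * inverse y \<in> commutator_subgroup"
      by (auto simp: ab_rel_def)
    obtain d where d: "lfrac_deg y = Fin d" using lfrac_deg_nonzero[OF nz(2)] by blast
    have "lfrac_deg x = lfrac_deg (x * inverse y) + lfrac_deg y"
      using nz by (simp add: lfrac_deg_mult[symmetric] mult.assoc)
    then show ?thesis
      using lfrac_deg_commutator_subgroup[OF c] d by simp
  qed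
qed

definition elementary_matrix :: "'q::division_ring ^ 'n ^ 'n \<Rightarrow> bool" where
  "elementary_matrix A \<longleftrightarrow>
     (\<exists>i j a. i \<noteq> j \<and> A = (\<chi> r s. if r = i \<and> s = j then a else if r = s then 1 else 0))"

text \<open>
  The index type carries no order, so no index is the last one;
  \<open>diag(1, \<dots>, 1, q)\<close> is rendered with \<open>q\<close> in an arbitrary diagonal position \<open>j\<close>.
\<close>

definition diag1 :: "'n \<Rightarrow> 'q::division_ring \<Rightarrow> 'q ^ 'n ^ 'n" where
  "diag1 j q = (\<chi> r s. if r = s then (if r = j then q else 1) else 0)"

text \<open>
  These properties determine \<open>D\<close> uniquely, because every invertible matrix is a product of
  elementary matrices and some \<open>diag1 j q\<close>.
\<close>

definition dieudonne_determinant :: "('q::division_ring ^ 'n ^ 'n \<Rightarrow> 'q ab) \<Rightarrow> bool" where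
  "dieudonne_determinant D \<longleftrightarrow>
     (\<forall>A B. D (A ** B) = D A * D B) \<and>
     (\<forall>A. \<not> invertible A \<longrightarrow> D A = 0) \<and>
     (\<forall>A. elementary_matrix A \<longrightarrow> D A = 1) \<and>
     (\<forall>j q. q \<noteq> 0 \<longrightarrow> D (diag1 j q) = ab_class q)"


section \<open>Closed subschemes of \<open>\<G>\<^sub>a\<^sup>n\<close>\<close>

text \<open>The coordinate ring \<open>k[x\<^sub>i : i \<in> 'n]\<close> of \<open>\<G>\<^sub>a\<^sup>n\<close>.\<close>

type_synonym ('n, 'k) mpoly = "('n \<Rightarrow>\<^sub>0 nat) \<Rightarrow>\<^sub>0 'k"

definition Const :: "'k::zero \<Rightarrow> ('n, 'k) mpoly" where
  "Const c = Poly_Mapping.single 0 c"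

definition Var :: "'n \<Rightarrow> ('n, 'k::zero_neq_one) mpoly" where
  "Var i = Poly_Mapping.single (Poly_Mapping.single i 1) 1"

text \<open>A commutative \<open>k\<close>-algebra is given by its structure map \<open>\<eta>\<close>.\<close>

definition algebra_structure :: "('k::field \<Rightarrow> 'a::comm_ring_1) \<Rightarrow> bool" where
  "algebra_structure \<eta> \<longleftrightarrow> \<eta> 1 = 1 \<and>
     (\<forall>a b. \<eta> (a + b) = \<eta> a + \<eta> b) \<and> (\<forall>a b. \<eta> (a * b) = \<eta> a * \<eta> b)"

definition mpoly_eval ::
  "('k::zero \<Rightarrow> 'a::comm_ring_1) \<Rightarrow> ('n::finite \<Rightarrow> 'a) \<Rightarrow> ('n, 'k) mpoly \<Rightarrow> 'a" where
  "mpoly_eval \<eta> x f =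
     (\<Sum>m\<in>Poly_Mapping.keys f. \<eta> (Poly_Mapping.lookup f m) * (\<Prod>i\<in>UNIV. x i ^ Poly_Mapping.lookup m i))"

text \<open>
  The endomorphism \<open>\<phi> \<in> M(n, R)\<close> on points with values in a \<open>k\<close>-algebra: the element
  \<open>\<Sum>\<^sub>m a\<^sub>m \<tau>\<^sup>m\<close> of \<open>R\<close> acts by \<open>x \<mapsto> \<Sum>\<^sub>m a\<^sub>m x\<^bsup>p\<^sup>m\<^esup>\<close>.
\<close>

definition Ga_endo ::
  "('k::field_prime_char \<Rightarrow> 'a::comm_ring_1) \<Rightarrow> 'k skew_poly ^ 'n ^ 'n \<Rightarrow> ('n::finite \<Rightarrow> 'a) \<Rightarrow> 'n \<Rightarrow> 'a"
  where
  "Ga_endo \<eta> \<phi> x i =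
     (\<Sum>j\<in>UNIV. \<Sum>m\<le>sp_degree (\<phi> $ i $ j). \<eta> (sp_coeff (\<phi> $ i $ j) m) * x j ^ (CHAR('k) ^ m))"

text \<open>
  \<open>ker \<phi>\<close> is the fibre of \<open>\<phi>\<close> over the origin, i.e. the closed subscheme defined by the ideal
  generated by the pullbacks \<open>\<phi>\<^sup>*(x\<^sub>i)\<close>. These are the values of \<open>\<phi>\<close> at the
  universal point \<open>(x\<^sub>i)\<close>.
\<close>

definition kernel_ideal :: "'k::field_prime_char skew_poly ^ 'n ^ 'n \<Rightarrow> ('n::finite, 'k) mpoly set"
  where "kernel_ideal \<phi> = module.span (*) (range (Ga_endo Const \<phi> Var))"

definition points ::
  "('k::field \<Rightarrow> 'a::comm_ring_1) \<Rightarrow> ('n::finite, 'k) mpoly set \<Rightarrow> ('n \<Rightarrow> 'a) set" where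
  "points \<eta> I = {x. \<forall>f\<in>I. mpoly_eval \<eta> x f = 0}"

text \<open>
  The closed subscheme defined by \<open>I\<close> is a subgroup scheme of \<open>\<G>\<^sub>a\<^sup>n\<close> iff \<open>I\<close> is a Hopf ideal for
  the comultiplication \<open>x\<^sub>i \<mapsto> x\<^sub>i \<otimes> 1 + 1 \<otimes> x\<^sub>i\<close>, the counit \<open>x\<^sub>i \<mapsto> 0\<close> and the antipode
  \<open>x\<^sub>i \<mapsto> - x\<^sub>i\<close>. Here \<open>k[x] \<otimes> k[x]\<close> is the polynomial ring over the index type \<open>'n + 'n\<close>, and
  \<open>I \<otimes> k[x] + k[x] \<otimes> I\<close> is the ideal generated by the two copies of \<open>I\<close>.
\<close>

definition closed_subgroup_scheme :: "('n::finite, 'k::field) mpoly set \<Rightarrow> bool" where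
  "closed_subgroup_scheme I \<longleftrightarrow>
     module.subspace (*) I \<and>
     (\<forall>f\<in>I. mpoly_eval Const (\<lambda>i. Var (Inl i) + Var (Inr i)) f \<in>
        module.span (*) (mpoly_eval Const (\<lambda>i. Var (Inl i)) ` I \<union>
                         mpoly_eval Const (\<lambda>i. Var (Inr i)) ` I
                         :: ('n + 'n, 'k) mpoly set)) \<and>
     (\<forall>f\<in>I. mpoly_eval id (\<lambda>_. 0) f = 0) \<and>
     (\<forall>f\<in>I. mpoly_eval Const (\<lambda>i. - Var i) f \<in> I)"

text \<open>\<open>k[x]/I\<close> has a \<open>k\<close>-basis consisting of the residue classes of \<open>N\<close> elements.\<close>

definition finite_of_rank :: "('n::finite, 'k::field) mpoly set \<Rightarrow> nat \<Rightarrow> bool" where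
  "finite_of_rank I N \<longleftrightarrow>
     (\<exists>B. finite B \<and> card B = N \<and>
        (\<forall>f. \<exists>!c :: ('n, 'k) mpoly \<Rightarrow> 'k.
           (\<forall>b. b \<notin> B \<longrightarrow> c b = 0) \<and> f - (\<Sum>b\<in>B. Const (c b) * b) \<in> I))"

end

theory Submission
  imports Defs
begin

text \<open>
  \<open>R\<close> has right division with remainder, so row operations over \<open>R\<close> bring \<open>\<phi>\<close> to a triangular
  matrix \<open>T\<close>. They change neither the ideal generated by the pullbacks \<open>\<phi>\<^sup>*(x\<^sub>i)\<close> nor the
  Dieudonne determinant. Over \<open>Q\<close>, back substitution turns \<open>T\<close> into its diagonal part, so
  \<open>deg det \<phi>\<close> is the sum of the degrees \<open>d\<^sub>i\<close> of the diagonal entries.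
  The ideal of \<open>T\<close> is generated by polynomials with leading terms \<open>a\<^sub>i x\<^sub>i\<^bsup>N\<^sub>i\<^esup>\<close>, where
  \<open>N\<^sub>i = p\<^bsup>d\<^sub>i\<^esup>\<close>, whose remaining monomials involve \<open>x\<^sub>i\<close> with exponent below \<open>N\<^sub>i\<close> and otherwise only later
  variables. Eliminating one variable at a time, the monomials with every exponent of \<open>x\<^sub>i\<close> below \<open>N\<^sub>i\<close>
  form a basis of the quotient.
\<close>

section \<open>Row operations\<close>

definition add_row :: "'n \<Rightarrow> 'n \<Rightarrow> 'a::ring_1 \<Rightarrow> 'a ^ 'm ^ 'n \<Rightarrow> 'a ^ 'm ^ 'n" where
  "add_row i j a M = (\<chi> r c. if r = i then M $ i $ c + a * M $ j $ c else M $ r $ c)"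

lemma add_row_nth:
  "add_row i j a M $ r $ c = (if r = i then M $ i $ c + a * M $ j $ c else M $ r $ c)"
  by (simp add: add_row_def)

lemma add_row_uminus: "i \<noteq> j \<Longrightarrow> add_row i j (- a) (add_row i j a M) = M"
  by (simp add: vec_eq_iff add_row_nth)

text \<open>Only additions of a left multiple of a row to a different row are allowed, since these
  are multiplications by elementary matrices and so do not change the determinant. Confining both
  rows to \<open>A\<close> protects the rows outside and any column that is already zero on
  \<open>A\<close>.\<close>

inductive row_equiv :: "'n set \<Rightarrow> 'a::ring_1 ^ 'm ^ 'n \<Rightarrow> 'a ^ 'm ^ 'n \<Rightarrow> bool" for A M where
  refl: "row_equiv A M M"
| add_row: "row_equiv A M N \<Longrightarrow> i \<in> A \<Longrightarrow> j \<in> A \<Longrightarrow> i \<noteq> j \<Longrightarrow> row_equiv A M (add_row i j a N)"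

lemma row_equiv_trans:
  assumes "row_equiv A L M" "row_equiv A M N"
  shows "row_equiv A L N"
  using assms(2) by induction (use assms(1) in \<open>auto intro: row_equiv.add_row\<close>)

lemma row_equiv_mono: "row_equiv A M N \<Longrightarrow> A \<subseteq> B \<Longrightarrow> row_equiv B M N"
  by (induction rule: row_equiv.induct) (auto intro: row_equiv.intros)

lemma row_equiv_outside: "row_equiv A M N \<Longrightarrow> r \<notin> A \<Longrightarrow> N $ r = M $ r"
  by (induction rule: row_equiv.induct) (auto simp: add_row_nth vec_eq_iff)

lemma row_equiv_zero_column:
  assumes "row_equiv A M N" "\<And>r. r \<in> A \<Longrightarrow> M $ r $ c = 0" "r \<in> A"
  shows "N $ r $ c = 0"
  using assms by (induction arbitrary: r rule: row_equiv.induct) (auto simp: add_row_nth)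

text \<open>Euclid's algorithm in column \<open>j\<close>. As long as two entries in rows of
  \<open>A\<close> are nonzero, the one of larger degree is replaced by its remainder modulo the
  other. The measure counts a nonzero entry as its degree plus one, so that it drops even when a
  constant becomes zero.\<close>

lemma clear_column:
  fixes M :: "'k::field_prime_char skew_poly ^ 'm ^ 'n"
  assumes "c \<in> A"
  shows "\<exists>N. row_equiv A M N \<and> (\<forall>r\<in>A - {c}. N $ r $ j = 0)"
proof (induction "\<Sum>r\<in>A. if M $ r $ j = 0 then 0 else Suc (sp_degree (M $ r $ j))"
    arbitrary: M rule: less_induct)
  case less
  show ?case
  proof (cases "\<exists>r\<in>A. \<exists>s\<in>A. r \<noteq> s \<and> M $ r $ j \<noteq> 0 \<and> M $ s $ j \<noteq> 0")
    case True
    then obtain r s where rs: "r \<in> A" "s \<in> A" "r \<noteq> s" "M $ r $ j \<noteq> 0" "M $ s $ j \<noteq> 0"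
      and le: "sp_degree (M $ s $ j) \<le> sp_degree (M $ r $ j)"
      using nat_le_linear by metis
    obtain q h where qh: "M $ r $ j = q * M $ s $ j + h" "h = 0 \<or> sp_degree h < sp_degree (M $ s $ j)"
      using sp_division[OF rs(5)] by blast
    define M' where "M' = add_row r s (- q) M"
    have o: "M' $ t $ j = M $ t $ j" if "t \<noteq> r" for t
      using that by (simp add: M'_def add_row_nth)
    have r: "M' $ r $ j = h" using qh(1) by (simp add: M'_def add_row_nth)
    have "(\<Sum>r\<in>A. if M' $ r $ j = 0 then 0 else Suc (sp_degree (M' $ r $ j)))
        < (\<Sum>r\<in>A. if M $ r $ j = 0 then 0 else Suc (sp_degree (M $ r $ j)))"
    proof (intro sum_strict_mono_ex1 ballI bexI[of _ r])
      fix t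
      show "(if M' $ t $ j = 0 then 0 else Suc (sp_degree (M' $ t $ j)))
          \<le> (if M $ t $ j = 0 then 0 else Suc (sp_degree (M $ t $ j)))"
        using r o[of t] rs le qh(2) by (cases "t = r") auto
    next
      show "(if M' $ r $ j = 0 then 0 else Suc (sp_degree (M' $ r $ j)))
          < (if M $ r $ j = 0 then 0 else Suc (sp_degree (M $ r $ j)))"
        unfolding r using rs(4) le qh(2) by auto
    qed (use rs(1) in simp_all)
    from less[OF this] obtain N where N: "row_equiv A M' N" "\<forall>r\<in>A - {c}. N $ r $ j = 0" by blast
    have "row_equiv A M M'"
      unfolding M'_def using rs by (intro row_equiv.intros)
    with N show ?thesis by (blast intro: row_equiv_trans)
  next
    case False
    show ?thesis
    proof (cases "\<exists>r\<in>A - {c}. M $ r $ j \<noteq> 0")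
      case False
      then show ?thesis using row_equiv.refl by blast
    next
      case True
      then obtain r where r: "r \<in> A" "r \<noteq> c" "M $ r $ j \<noteq> 0" by blast
      have 0: "M $ s $ j = 0" if "s \<in> A" "s \<noteq> r" for s
        using False r that by blast
      \<comment> \<open>The only nonzero entry is moved to row \<open>c\<close> without a swap: it
        is added to the zero entry there and then cancelled in row \<open>r\<close>.\<close>
      let ?N = "add_row r c (- 1) (add_row c r 1 M)"
      have "row_equiv A M ?N"
        using r assms by (intro row_equiv.intros) auto
      moreover have "?N $ s $ j = 0" if "s \<in> A - {c}" for s
        using that 0 r assms by (auto simp: add_row_nth)
      ultimately show ?thesis by blast
    qed
  qed
qed

text \<open>The injection \<open>f\<close> orders the indices. Columns are cleared in this order,
  and at stage \<open>m\<close> only rows with \<open>f\<close>-value at least \<open>m\<close> take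
  part. These vanish in all earlier columns, so nothing achieved before is lost.\<close>

lemma triangularize:
  fixes M :: "'k::field_prime_char skew_poly ^ 'n ^ 'n" and f :: "'n \<Rightarrow> nat"
  assumes "inj f"
  shows "\<exists>T. row_equiv UNIV M T \<and> (\<forall>i j. f j < f i \<longrightarrow> T $ i $ j = 0)"
proof -
  have "\<exists>T. row_equiv UNIV M T \<and> (\<forall>i j. f j < m \<longrightarrow> f j < f i \<longrightarrow> T $ i $ j = 0)" for m
  proof (induction m)
    case 0
    show ?case using row_equiv.refl by auto
  next
    case (Suc m)
    then obtain T where T: "row_equiv UNIV M T"
      "\<And>i j. f j < m \<Longrightarrow> f j < f i \<Longrightarrow> T $ i $ j = 0" by blast
    show ?case
    proof (cases "\<exists>c. f c = m")
      case False
      then show ?thesis using T by (metis less_SucE)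
    next
      case True
      then obtain c where c: "f c = m" by blast
      define A where "A = {i. m \<le> f i}"
      have "c \<in> A" using c by (simp add: A_def)
      from clear_column[OF this, of T c] obtain N where
        N: "row_equiv A T N" "\<And>r. r \<in> A - {c} \<Longrightarrow> N $ r $ c = 0" by blast
      have "N $ i $ j = 0" if ij: "f j < Suc m" "f j < f i" for i j
      proof (cases "f j < m")
        case True
        show ?thesis
        proof (cases "i \<in> A")
          case iA: True
          show ?thesis
            by (rule row_equiv_zero_column[OF N(1) _ iA]) (use True T(2) in \<open>auto simp: A_def\<close>)
        next
          case False
          then show ?thesis using row_equiv_outside[OF N(1) False] T(2)[OF True ij(2)] by simp
        qed
      next
        case False
        then have "j = c" using ij(1) c injD[OF assms] by (metis less_SucE)
        moreover have "i \<in> A - {c}" using ij c False by (auto simp: A_def)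
        ultimately show ?thesis using N(2) by blast
      qed
      moreover have "row_equiv UNIV M N"
        using T(1) row_equiv_mono[OF N(1)] row_equiv_trans by blast
      ultimately show ?thesis by blast
    qed
  qed
  from this[of "Suc (Max (range f))"] show ?thesis
    by (metis (mono_tags, lifting) Max_ge finite finite_imageI less_Suc_eq_le rangeI)
qed

section \<open>Diagonalization over the skew field and the Dieudonne determinant\<close>

lemma to_lfrac_0: "to_lfrac 0 = 0"
  by (simp add: to_lfrac_def zero_lfrac_def)

lemma to_lfrac_add: "to_lfrac (a + b) = to_lfrac a + to_lfrac b"
  by (simp add: to_lfrac_def LFrac_add)

lemma to_lfrac_mult: "to_lfrac (a * b) = to_lfrac a * to_lfrac b"
  using LFrac_mult[of 1 1 a b] by (simp add: to_lfrac_def)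

lemma map_matrix_to_lfrac_row_equiv:
  "row_equiv A M N \<Longrightarrow> row_equiv A (map_matrix to_lfrac M) (map_matrix to_lfrac N)"
proof (induction rule: row_equiv.induct)
  case (add_row N i j a)
  have "map_matrix to_lfrac (add_row i j a N) = add_row i j (to_lfrac a) (map_matrix to_lfrac N)"
    by (simp add: vec_eq_iff add_row_nth map_matrix_def to_lfrac_add to_lfrac_mult)
  with add_row show ?case by (simp add: row_equiv.add_row)
qed (rule row_equiv.refl)

text \<open>A row operation is left multiplication by an elementary matrix, whose determinant is
  1.\<close>

lemma dieudonne_determinant_row_equiv:
  fixes M :: "'q::division_ring ^ 'n ^ 'n"
  assumes D: "dieudonne_determinant D" and "row_equiv A M N"
  shows "D N = D M"
  using assms(2)
proof induction
  case (add_row N i j a)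
  define E :: "'q ^ 'n ^ 'n" where "E = (\<chi> r s. if r = i \<and> s = j then a else if r = s then 1 else 0)"
  have "elementary_matrix E"
    unfolding elementary_matrix_def E_def using add_row by blast
  then have "D E = 1" using D by (simp add: dieudonne_determinant_def)
  have "(E ** N) $ r $ c = add_row i j a N $ r $ c" for r c
  proof (cases "r = i")
    case True
    have "(E ** N) $ r $ c = (\<Sum>k\<in>UNIV. (if k = j then a * N $ j $ c else 0) + (if k = i then N $ i $ c else 0))"
      unfolding matrix_matrix_mult_def E_def using True add_row
      by (auto intro!: sum.cong)
    then show ?thesis using True by (simp add: sum.distrib add_row_nth add.commute)
  next
    case False
    have "(E ** N) $ r $ c = (\<Sum>k\<in>UNIV. if k = r then N $ r $ c else 0)"
      unfolding matrix_matrix_mult_def E_def vec_lambda_beta using False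
      by (intro sum.cong) auto
    then show ?thesis using False by (simp add: add_row_nth)
  qed
  then have "E ** N = add_row i j a N" by (simp add: vec_eq_iff)
  moreover have "D (E ** N) = D E * D N" using D by (simp add: dieudonne_determinant_def)
  ultimately show ?case using \<open>D E = 1\<close> add_row by simp
qed simp

text \<open>Row \<open>c\<close> is supported on the diagonal, so adding left multiples of it to
  other rows alters column \<open>c\<close> only. The rows are treated one at a time.\<close>

lemma clear_above:
  fixes M :: "'q::division_ring ^ 'n ^ 'n"
  assumes "M $ c $ c \<noteq> 0" and "\<And>j. j \<noteq> c \<Longrightarrow> M $ c $ j = 0"
  shows "\<exists>N. row_equiv UNIV M N \<and> (\<forall>i j. N $ i $ j = (if j = c \<and> i \<noteq> c then 0 else M $ i $ j))"
proof -
  have "\<exists>N. row_equiv UNIV M N \<and> (\<forall>i j. N $ i $ j = (if j = c \<and> i \<in> A then 0 else M $ i $ j))"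
    if "c \<notin> A" for A
    using finite[of A] that
  proof (induction A rule: finite_induct)
    case empty
    then show ?case using row_equiv.refl by auto
  next
    case (insert r A)
    then obtain N where N: "row_equiv UNIV M N"
      "\<And>i j. N $ i $ j = (if j = c \<and> i \<in> A then 0 else M $ i $ j)" by auto
    let ?N = "add_row r c (- (M $ r $ c * inverse (M $ c $ c))) N"
    have "row_equiv UNIV M ?N"
      using N(1) insert by (intro row_equiv.add_row) auto
    moreover have "?N $ i $ j = (if j = c \<and> i \<in> insert r A then 0 else M $ i $ j)" for i j
      using insert assms by (auto simp: add_row_nth N(2) mult.assoc)
    ultimately show ?case by blast
  qed
  from this[of "- {c}"] show ?thesis by auto
qed

lemma zero_row_not_invertible:
  fixes M :: "'q::division_ring ^ 'n ^ 'n"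
  assumes "\<And>j. M $ i $ j = 0"
  shows "\<not> invertible M"
proof
  assume "invertible M"
  then obtain N where "M ** N = mat 1" by (auto simp: invertible_def)
  then have "(M ** N) $ i $ i = 1" by (simp add: mat_def)
  then show False using assms by (simp add: matrix_matrix_mult_def)
qed

text \<open>Back substitution from the largest \<open>f\<close>-value downwards. When the row
  \<open>c\<close> with \<open>f c = m\<close> is reached, the later columns are already cleared, so
  row \<open>c\<close> has at most its diagonal entry. If that entry were zero, the matrix would
  have a zero row, hence determinant 0.\<close>

lemma triangular_row_equiv_diagonal:
  fixes T :: "'q::division_ring ^ 'n ^ 'n" and f :: "'n \<Rightarrow> nat"
  assumes D: "dieudonne_determinant D" "D T \<noteq> 0"
    and f: "inj f" and T: "\<And>i j. f j < f i \<Longrightarrow> T $ i $ j = 0"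
  shows "(\<forall>i. T $ i $ i \<noteq> 0) \<and> row_equiv UNIV T (\<chi> i j. if i = j then T $ i $ i else 0)"
proof -
  define n where "n = Suc (Max (range f))"
  have n: "f i < n" for i
    unfolding n_def by (simp add: less_Suc_eq_le)
  have "(\<forall>i. m \<le> f i \<longrightarrow> T $ i $ i \<noteq> 0) \<and>
      row_equiv UNIV T (\<chi> i j. if i \<noteq> j \<and> m \<le> f j then 0 else T $ i $ j)" if "m \<le> n" for m
    using that
  \<comment> \<open>The induction descends from \<open>n\<close>, where no column has been treated,
    to 0.\<close>
  proof (induction m rule: inc_induct)
    case base
    have "(\<chi> i j. if i \<noteq> j \<and> n \<le> f j then 0 else T $ i $ j) = T"
      using n by (simp add: vec_eq_iff not_le[symmetric])
    then show ?case using n row_equiv.refl[of UNIV T] by (auto simp: not_le[symmetric])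
  next
    case (step m)
    define M where "M = (\<chi> i j. if i \<noteq> j \<and> Suc m \<le> f j then 0 else T $ i $ j)"
    have M: "row_equiv UNIV T M" and nz: "\<And>i. Suc m \<le> f i \<Longrightarrow> T $ i $ i \<noteq> 0"
      using step by (auto simp: M_def)
    show ?case
    proof (cases "\<exists>c. f c = m")
      case False
      then have "m \<le> f i \<longleftrightarrow> Suc m \<le> f i" for i by (metis Suc_leI le_eq_less_or_eq Suc_leD)
      then show ?thesis using step by simp
    next
      case True
      then obtain c where c: "f c = m" by blast
      have row: "M $ c $ j = 0" if "j \<noteq> c" for j
        using that T[of j c] c injD[OF f, of j c]
        by (cases "f j" "f c" rule: linorder_cases) (auto simp: M_def)
      have Mcc: "M $ c $ c = T $ c $ c" by (simp add: M_def)
      have ne: "T $ c $ c \<noteq> 0"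
      proof
        assume "T $ c $ c = 0"
        then have "\<not> invertible M"
          using row Mcc by (intro zero_row_not_invertible[of _ c]) metis
        then have "D M = 0" using D(1) by (simp add: dieudonne_determinant_def)
        then show False using dieudonne_determinant_row_equiv[OF D(1) M] D(2) by simp
      qed
      obtain N where N: "row_equiv UNIV M N"
        "\<forall>i j. N $ i $ j = (if j = c \<and> i \<noteq> c then 0 else M $ i $ j)"
        using clear_above[of M c] ne Mcc row by auto
      have eq: "m \<le> f j \<longleftrightarrow> Suc m \<le> f j \<or> j = c" for j
        unfolding le_eq_less_or_eq[of m] Suc_le_eq using c inj_eq[OF f] by metis
      have "N = (\<chi> i j. if i \<noteq> j \<and> m \<le> f j then 0 else T $ i $ j)"
        using N(2) by (auto simp: vec_eq_iff M_def eq)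
      then show ?thesis using M N(1) row_equiv_trans nz ne eq by blast
    qed
  qed
  from this[of 0] have *: "(\<forall>i. T $ i $ i \<noteq> 0)"
    "row_equiv UNIV T (\<chi> i j. if i \<noteq> j then 0 else T $ i $ j)" by auto
  moreover have "(\<chi> i j. if i \<noteq> j then 0 else T $ i $ j) = (\<chi> i j. if i = j then T $ i $ i else 0)"
    by (simp add: vec_eq_iff)
  ultimately show ?thesis by simp
qed

text \<open>A diagonal matrix is a product of matrices \<open>diag1 i (q i)\<close>; the diagonal
  entries are switched on one after another.\<close>

lemma dieudonne_determinant_diagonal:
  fixes q :: "'n::finite \<Rightarrow> 'q::division_ring"
  assumes D: "dieudonne_determinant D" and q: "\<And>i. q i \<noteq> 0"
  shows "D (\<chi> i j. if i = j then q i else 0) = (\<Prod>i\<in>UNIV. ab_class (q i))"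
proof -
  have "D (\<chi> i j. if i = j then (if i \<in> A then q i else 1) else 0) = (\<Prod>i\<in>A. ab_class (q i))" for A
    using finite[of A]
  proof (induction A rule: finite_induct)
    case empty
    \<comment> \<open>For \<open>q = 1\<close> the matrix \<open>diag1 j q\<close> is the identity,
      whatever the position \<open>j\<close>.\<close>
    have "D (diag1 undefined 1) = ab_class 1"
      using D by (simp add: dieudonne_determinant_def)
    moreover have "diag1 undefined 1 = (\<chi> i j. if i = j then (if i \<in> {} then q i else 1) else 0)"
      by (simp add: vec_eq_iff diag1_def)
    ultimately show ?case by (simp add: one_ab_def)
  next
    case (insert a A)
    let ?M = "\<lambda>A. (\<chi> i j. if i = j then (if i \<in> A then q i else 1) else 0) :: 'q ^ 'n ^ 'n"
    have "(diag1 a (q a) ** ?M A) $ i $ j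
        = (\<Sum>k\<in>UNIV. if k = i then (if i = j then (if i \<in> insert a A then q i else 1) else 0) else 0)" for i j
      unfolding matrix_matrix_mult_def diag1_def vec_lambda_beta using insert
      by (intro sum.cong) auto
    then have "?M (insert a A) = diag1 a (q a) ** ?M A"
      by (simp add: vec_eq_iff)
    then have "D (?M (insert a A)) = D (diag1 a (q a)) * D (?M A)"
      using D by (simp add: dieudonne_determinant_def)
    also have "D (diag1 a (q a)) = ab_class (q a)"
      using D q by (simp add: dieudonne_determinant_def)
    finally show ?case using insert by simp
  qed
  from this[of UNIV] show ?thesis by (simp cong: if_cong)
qed

section \<open>The degree of the determinant of a triangular matrix\<close>

lemma ab_deg_0: "ab_deg 0 = Pinf"
  by transfer (simp add: lfrac_deg_eq_Pinf_iff)

lemma ab_deg_class: "ab_deg (ab_class x) = lfrac_deg x"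
  by transfer simp

lemma ab_deg_mult: "ab_deg (x * y) = ab_deg x + ab_deg y"
  by transfer (rule lfrac_deg_mult)

lemma ab_deg_prod_to_lfrac:
  fixes r :: "'i \<Rightarrow> 'k::field_prime_char skew_poly"
  assumes "finite A" "\<And>i. i \<in> A \<Longrightarrow> r i \<noteq> 0"
  shows "ab_deg (\<Prod>i\<in>A. ab_class (to_lfrac (r i))) = Fin (int (\<Sum>i\<in>A. sp_degree (r i)))"
  using assms
proof (induction A rule: finite_induct)
  case empty
  then show ?case by (simp add: one_ab_def ab_deg_class lfrac_deg_one)
next
  case (insert a A)
  \<comment> \<open>The denominators introduced by \<open>to_lfrac\<close> contribute nothing:
    additivity of the degree gives deg 1 = 2 deg 1.\<close>
  have "sp_degree (1 :: 'k skew_poly) = 0"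
    using sp_degree_mult[of "1 :: 'k skew_poly" 1] by simp
  with insert show ?case
    by (simp add: ab_deg_mult ab_deg_class to_lfrac_def lfrac_deg_LFrac)
qed

text \<open>Finite degree means nonzero determinant, which forces nonzero diagonal entries.
  Diagonalization takes place over \<open>Q\<close> but keeps the diagonal, whose entries come from
  \<open>R\<close>; hence the degree is a sum of natural numbers.\<close>

lemma triangular_form:
  fixes \<phi> :: "'k::field_prime_char skew_poly ^ 'n ^ 'n" and f :: "'n \<Rightarrow> nat"
  assumes D: "dieudonne_determinant ddet" and deg: "ab_deg (ddet (map_matrix to_lfrac \<phi>)) < Pinf"
    and f: "inj f"
  obtains T where "row_equiv UNIV \<phi> T" "\<And>i j. f j < f i \<Longrightarrow> T $ i $ j = 0" "\<And>i. T $ i $ i \<noteq> 0"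
    "ab_deg (ddet (map_matrix to_lfrac \<phi>)) = Fin (int (\<Sum>i\<in>UNIV. sp_degree (T $ i $ i)))"
proof -
  obtain T where T: "row_equiv UNIV \<phi> T" "\<And>i j. f j < f i \<Longrightarrow> T $ i $ j = 0"
    using triangularize[OF f] by blast
  let ?T = "map_matrix to_lfrac T"
  have eq: "ddet (map_matrix to_lfrac \<phi>) = ddet ?T"
    using dieudonne_determinant_row_equiv[OF D map_matrix_to_lfrac_row_equiv[OF T(1)]] by simp
  have nz: "ddet ?T \<noteq> 0"
    using deg eq by (metis ab_deg_0 less_irrefl)
  have *: "\<forall>i. ?T $ i $ i \<noteq> 0" "row_equiv UNIV ?T (\<chi> i j. if i = j then ?T $ i $ i else 0)"
    using triangular_row_equiv_diagonal[OF D nz f] T(2) by (simp_all add: map_matrix_def to_lfrac_0)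
  have ne: "T $ i $ i \<noteq> 0" for i
    using *(1)[rule_format, of i] by (auto simp: map_matrix_def to_lfrac_0)
  have "ddet ?T = ddet (\<chi> i j. if i = j then ?T $ i $ i else 0)"
    using dieudonne_determinant_row_equiv[OF D *(2)] by simp
  also have "\<dots> = (\<Prod>i\<in>UNIV. ab_class (?T $ i $ i))"
    using *(1) by (intro dieudonne_determinant_diagonal[OF D]) blast
  finally have "ab_deg (ddet (map_matrix to_lfrac \<phi>)) = Fin (int (\<Sum>i\<in>UNIV. sp_degree (T $ i $ i)))"
    using ab_deg_prod_to_lfrac[of UNIV "\<lambda>i. T $ i $ i"] ne eq by (simp add: map_matrix_def)
  with T ne that show thesis by blast
qed

section \<open>The kernel as a closed subgroup scheme\<close>

lemma poly_mapping_eq_sum_single: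
  "f = (\<Sum>m\<in>Poly_Mapping.keys f. Poly_Mapping.single m (Poly_Mapping.lookup f m))"
  by (rule poly_mapping_eqI) (simp add: lookup_sum lookup_single when_def in_keys_iff)

text \<open>Additive statements about polynomials reduce to single terms; the zero polynomial is the
  term with coefficient 0.\<close>

lemma poly_mapping_single_induct [case_names single add]:
  assumes "\<And>m c. P (Poly_Mapping.single m c)" and "\<And>f g. P f \<Longrightarrow> P g \<Longrightarrow> P (f + g)"
  shows "P (f :: 'a \<Rightarrow>\<^sub>0 'b::comm_monoid_add)"
proof -
  have sum: "P (\<Sum>m\<in>A. Poly_Mapping.single m (Poly_Mapping.lookup f m))" if "finite A" for A
    using that
  proof (induction A rule: finite_induct)
    case empty
    show ?case using assms(1)[of undefined 0] by simp
  qed (simp add: assms)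
  from sum[OF finite_keys] show ?thesis
    by (subst poly_mapping_eq_sum_single) blast
qed

text \<open>For the ring as a module over itself, \<open>subspace\<close> means ideal and
  \<open>span\<close> the ideal generated by a set.\<close>

interpretation ideal: module "(*) :: 'a::comm_ring_1 \<Rightarrow> 'a \<Rightarrow> 'a"
  by unfold_locales (simp_all add: algebra_simps)

text \<open>Whether a ring homomorphism maps one ideal into another is decided on generators. The
  homomorphisms in question are evaluation at a point, comultiplication and antipode.\<close>

lemma ideal_span_hom_image:
  fixes h :: "'a::comm_ring_1 \<Rightarrow> 'b::comm_ring_1"
  assumes "\<And>a b. h (a + b) = h a + h b" "\<And>a b. h (a * b) = h a * h b"
    and "\<And>s. s \<in> S \<Longrightarrow> h s \<in> ideal.span T" and "f \<in> ideal.span S"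
  shows "h f \<in> ideal.span T"
  using assms(4)
proof (induction rule: ideal.span_induct_alt)
  case base
  have "h 0 = 0" using assms(1)[of 0 0] by simp
  then show ?case by (simp add: ideal.span_zero)
next
  case (step c x y)
  then show ?case by (simp add: assms ideal.span_add ideal.span_scale)
qed

section \<open>Evaluation of polynomials as a ring homomorphism\<close>

context
  fixes \<eta> :: "'k::field \<Rightarrow> 'a::comm_ring_1"
  assumes alg: "algebra_structure \<eta>"
begin

lemma algebra_structure_simps:
  "\<eta> 1 = 1" "\<eta> (a + b) = \<eta> a + \<eta> b" "\<eta> (a * b) = \<eta> a * \<eta> b" "\<eta> 0 = 0" "\<eta> (a ^ n) = \<eta> a ^ n"
  "\<eta> (of_nat n) = of_nat n" "\<eta> (sum f A) = (\<Sum>i\<in>A. \<eta> (f i))"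
proof -
  show *: "\<eta> 1 = 1" "\<And>a b. \<eta> (a + b) = \<eta> a + \<eta> b" "\<And>a b. \<eta> (a * b) = \<eta> a * \<eta> b"
    using alg by (simp_all add: algebra_structure_def)
  show 0: "\<eta> 0 = 0" using *(2)[of 0 0] by simp
  show "\<eta> (a ^ n) = \<eta> a ^ n" by (induction n) (simp_all add: *)
  show "\<eta> (of_nat n) = of_nat n" by (induction n) (simp_all add: * 0)
  show "\<eta> (sum f A) = (\<Sum>i\<in>A. \<eta> (f i))" by (induction A rule: infinite_finite_induct) (simp_all add: * 0)
qed

lemma mpoly_eval_single:
  "mpoly_eval \<eta> x (Poly_Mapping.single m c) = \<eta> c * (\<Prod>i\<in>UNIV. x i ^ Poly_Mapping.lookup m i)"
  by (simp add: mpoly_eval_def algebra_structure_simps)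

lemma mpoly_eval_add: "mpoly_eval \<eta> x (f + g) = mpoly_eval \<eta> x f + mpoly_eval \<eta> x g"
  unfolding mpoly_eval_def
  by (rule setsum_keys_plus_distrib) (simp_all only: algebra_structure_simps distrib_right mult_zero_left)

lemma mpoly_eval_0: "mpoly_eval \<eta> x 0 = 0"
  by (simp add: mpoly_eval_def)

lemma mpoly_eval_sum: "mpoly_eval \<eta> x (sum f A) = (\<Sum>i\<in>A. mpoly_eval \<eta> x (f i))"
  by (induction A rule: infinite_finite_induct) (simp_all add: mpoly_eval_add mpoly_eval_0)

lemma mpoly_eval_mult: "mpoly_eval \<eta> x (f * g) = mpoly_eval \<eta> x f * mpoly_eval \<eta> x g"
proof (induction f rule: poly_mapping_single_induct)
  case (single m c)
  show ?case
  proof (induction g rule: poly_mapping_single_induct)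
    case (single l d)
    show ?case
      unfolding mult_single mpoly_eval_single lookup_add power_add prod.distrib
      by (simp only: algebra_structure_simps mult.assoc mult.left_commute)
  qed (simp add: distrib_left mpoly_eval_add)
qed (simp add: distrib_right mpoly_eval_add)

lemma mpoly_eval_Const: "mpoly_eval \<eta> x (Const c) = \<eta> c"
  by (simp add: Const_def mpoly_eval_single)

lemma mpoly_eval_Var: "mpoly_eval \<eta> x (Var i) = x i"
proof -
  have "(\<Prod>j\<in>UNIV. x j ^ Poly_Mapping.lookup (Poly_Mapping.single i 1) j) = (\<Prod>j\<in>UNIV. if j = i then x i else 1)"
    by (intro prod.cong) (auto simp: lookup_single)
  then show ?thesis
    by (simp add: Var_def mpoly_eval_single algebra_structure_simps)
qed

lemma mpoly_eval_power: "mpoly_eval \<eta> x (f ^ n) = mpoly_eval \<eta> x f ^ n"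
proof (induction n)
  case 0
  have "mpoly_eval \<eta> x (Const 1) = 1" by (simp only: mpoly_eval_Const algebra_structure_simps)
  then show ?case by (simp add: Const_def)
qed (simp add: mpoly_eval_mult)

end

lemma algebra_structure_Const: "algebra_structure (Const :: 'k::field \<Rightarrow> ('n::finite, 'k) mpoly)"
  by (simp add: algebra_structure_def Const_def single_add mult_single)

lemma algebra_structure_id: "algebra_structure (id :: 'k::field \<Rightarrow> 'k)"
  by (simp add: algebra_structure_def)

section \<open>The additive action of \<open>R\<close> on commutative algebras\<close>

definition sp_act ::
  "('k::field_prime_char \<Rightarrow> 'a::comm_ring_1) \<Rightarrow> 'k skew_poly \<Rightarrow> 'a \<Rightarrow> 'a" where
  "sp_act \<eta> r x = (\<Sum>m\<le>sp_degree r. \<eta> (sp_coeff r m) * x ^ (CHAR('k) ^ m))"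

lemma Ga_endo_eq: "Ga_endo \<eta> \<phi> x i = (\<Sum>j\<in>UNIV. sp_act \<eta> (\<phi> $ i $ j) (x j))"
  by (simp add: Ga_endo_def sp_act_def)

context
  fixes \<eta> :: "'k::field_prime_char \<Rightarrow> 'a::comm_ring_1"
  assumes alg: "algebra_structure \<eta>"
begin

text \<open>The characteristic of \<open>'a\<close> divides the prime \<open>CHAR('k)\<close> and is
  not 1, because 0 and 1 differ in \<open>'a\<close>. Therefore the powers of Frobenius are additive
  on \<open>'a\<close>.\<close>

lemma algebra_CHAR: "CHAR('a) = CHAR('k)"
proof -
  have "of_nat CHAR('k) = (0 :: 'a)"
    using algebra_structure_simps(6)[OF alg, of "CHAR('k)"] algebra_structure_simps(4)[OF alg] by simp
  then have "CHAR('a) dvd CHAR('k)"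
    by (simp add: of_nat_eq_0_iff_char_dvd)
  moreover have "prime CHAR('k)" by simp
  ultimately show ?thesis
    by (auto simp: prime_nat_iff)
qed

lemma frobenius_sum:
  "sum f A ^ (CHAR('k) ^ m) = (\<Sum>i\<in>A. (f i :: 'a) ^ (CHAR('k) ^ m))"
  by (rule freshmans_dream_sum') (simp_all add: algebra_CHAR)

lemma frobenius_add: "(x + y :: 'a) ^ (CHAR('k) ^ m) = x ^ (CHAR('k) ^ m) + y ^ (CHAR('k) ^ m)"
  by (rule freshmans_dream') (simp_all add: algebra_CHAR)

lemma sp_act_eq:
  assumes "sp_degree r \<le> n"
  shows "sp_act \<eta> r x = (\<Sum>m\<le>n. \<eta> (sp_coeff r m) * x ^ (CHAR('k) ^ m))"
  unfolding sp_act_def using assms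
  by (intro sum.mono_neutral_left) (auto simp: sp_coeff_eq_0 algebra_structure_simps[OF alg])

lemma sp_act_add_left: "sp_act \<eta> (r + s) x = sp_act \<eta> r x + sp_act \<eta> s x"
proof -
  define n where "n = Max {sp_degree r, sp_degree s, sp_degree (r + s)}"
  have "sp_degree r \<le> n" "sp_degree s \<le> n" "sp_degree (r + s) \<le> n" by (auto simp: n_def)
  then show ?thesis
    by (simp add: sp_act_eq[of _ n] plus_skew_poly.rep_eq algebra_structure_simps[OF alg]
        distrib_right sum.distrib)
qed

lemma sp_act_0_left: "sp_act \<eta> 0 x = 0"
  by (simp add: sp_act_def zero_skew_poly.rep_eq algebra_structure_simps[OF alg])

lemma sp_act_add_right: "sp_act \<eta> r (x + y) = sp_act \<eta> r x + sp_act \<eta> r y"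
  by (simp add: sp_act_def frobenius_add distrib_left sum.distrib)

lemma sp_act_0_right: "sp_act \<eta> r 0 = 0"
  using sp_act_add_right[of r 0 0] by simp

lemma sp_act_uminus: "sp_act \<eta> r (- x) = - sp_act \<eta> r x"
  using sp_act_add_right[of r x "- x"] by (simp add: sp_act_0_right minus_unique)

lemma sp_act_sum_right: "sp_act \<eta> r (sum f A) = (\<Sum>i\<in>A. sp_act \<eta> r (f i))"
  by (induction A rule: infinite_finite_induct) (simp_all add: sp_act_add_right sp_act_0_right)

text \<open>Products in \<open>R\<close> act as compositions: applying the \<open>i\<close>-th power
  of Frobenius to a term \<open>b x^(p^j)\<close> also raises \<open>b\<close> to the power
  \<open>p^i\<close>, which is the twist in the multiplication of \<open>R\<close>.\<close>

lemma sp_act_mult: "sp_act \<eta> (r * s) x = sp_act \<eta> r (sp_act \<eta> s x)"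
proof -
  let ?p = "CHAR('k)"
  define g where "g = (\<lambda>i j. \<eta> (sp_coeff r i) * (\<eta> (sp_coeff s j) ^ (?p ^ i) * x ^ (?p ^ (i + j))))"
  let ?n = "sp_degree r + sp_degree s"
  have pp: "(x ^ (?p ^ j)) ^ (?p ^ i) = x ^ (?p ^ (i + j))" for x :: 'a and i j
    by (metis power_mult power_add mult.commute)
  have g0: "g i j = 0" if "\<not> (i \<le> sp_degree r \<and> j \<le> sp_degree s)" for i j
  proof -
    have "\<eta> (sp_coeff r i) = 0 \<or> \<eta> (sp_coeff s j) = 0"
      using that sp_coeff_eq_0[of r i] sp_coeff_eq_0[of s j] algebra_structure_simps(4)[OF alg]
      by (metis not_le)
    then show ?thesis by (auto simp: g_def power_0_left)
  qed
  have "sp_act \<eta> (r * s) x = (\<Sum>k\<le>?n. \<eta> (sp_coeff (r * s) k) * x ^ (?p ^ k))"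
    by (rule sp_act_eq) (rule sp_degree_mult_le)
  also have "\<dots> = (\<Sum>k\<le>?n. \<Sum>i\<le>k. g i (k - i))"
    unfolding times_skew_poly.rep_eq algebra_structure_simps[OF alg] sum_distrib_right g_def
    by (intro sum.cong) (simp_all only: atMost_iff le_add_diff_inverse mult.assoc)
  also have "\<dots> = (\<Sum>(i, j)\<in>{(i, j). i + j \<le> ?n}. g i j)"
    by (rule sum.triangle_reindex_eq[symmetric])
  \<comment> \<open>The rectangle lies in the triangle, and terms outside it contain a coefficient
    beyond the degree of \<open>r\<close> or \<open>s\<close>.\<close>
  also have "\<dots> = (\<Sum>(i, j)\<in>{..sp_degree r} \<times> {..sp_degree s}. g i j)"
  proof (rule sum.mono_neutral_right)
    show "finite {(i, j). i + j \<le> ?n}"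
      by (rule finite_subset[of _ "{..?n} \<times> {..?n}"]) auto
    show "\<forall>ij\<in>{(i, j). i + j \<le> ?n} - {..sp_degree r} \<times> {..sp_degree s}. (case ij of (i, j) \<Rightarrow> g i j) = 0"
      using g0 by force
  qed auto
  also have "\<dots> = sp_act \<eta> r (sp_act \<eta> s x)"
    unfolding sum.cartesian_product[symmetric] sp_act_def frobenius_sum sum_distrib_left
      power_mult_distrib pp g_def ..
  finally show ?thesis .
qed

text \<open>Naturality of \<phi>: it commutes with the homomorphism of algebras given by evaluation
  at \<open>x\<close>.\<close>

lemma mpoly_eval_Ga_endo:
  fixes x :: "'m::finite \<Rightarrow> 'a"
  shows "mpoly_eval \<eta> x (Ga_endo Const \<phi> g i) = Ga_endo \<eta> \<phi> (\<lambda>j. mpoly_eval \<eta> x (g j)) i"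
  by (simp add: Ga_endo_def mpoly_eval_sum[OF alg] mpoly_eval_mult[OF alg] mpoly_eval_power[OF alg]
      mpoly_eval_Const[OF alg])

lemma Ga_endo_add: "Ga_endo \<eta> \<phi> (\<lambda>j. x j + y j) i = Ga_endo \<eta> \<phi> x i + Ga_endo \<eta> \<phi> y i"
  by (simp add: Ga_endo_eq sp_act_add_right sum.distrib)

lemma Ga_endo_uminus: "Ga_endo \<eta> \<phi> (\<lambda>j. - x j) i = - Ga_endo \<eta> \<phi> x i"
  by (simp add: Ga_endo_eq sp_act_uminus sum_negf)

lemma Ga_endo_0: "Ga_endo \<eta> \<phi> (\<lambda>j. 0) i = 0"
  by (simp add: Ga_endo_eq sp_act_0_right)

lemma Ga_endo_add_row:
  "Ga_endo \<eta> (add_row i j a \<phi>) x r =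
     (if r = i then Ga_endo \<eta> \<phi> x i + sp_act \<eta> a (Ga_endo \<eta> \<phi> x j) else Ga_endo \<eta> \<phi> x r)"
  by (simp add: Ga_endo_eq add_row_nth sp_act_add_left sp_act_mult sp_act_sum_right sum.distrib)

text \<open>Elements of \<open>R\<close> act by polynomials without constant term: the exponents
  \<open>p^m\<close> are positive, so each term is a multiple of \<open>x\<close>.\<close>

lemma sp_act_in_ideal:
  assumes "x \<in> ideal.span S"
  shows "sp_act \<eta> r x \<in> ideal.span S"
proof -
  have "x ^ (CHAR('k) ^ m) = x ^ (CHAR('k) ^ m - 1) * x" for m
    by (metis power_minus_mult zero_less_power CHAR_pos)
  then show ?thesis
    unfolding sp_act_def using assms by (metis (no_types, lifting) ideal.span_sum ideal.span_scale)
qed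

end

lemma mpoly_eval_Ga_endo_Var:
  assumes "algebra_structure \<eta>"
  shows "mpoly_eval \<eta> x (Ga_endo Const \<phi> Var i) = Ga_endo \<eta> \<phi> x i"
  by (simp add: mpoly_eval_Ga_endo[OF assms] mpoly_eval_Var[OF assms])

section \<open>The ideal of the kernel and its Hopf structure\<close>

lemma Ga_endo_in_kernel_ideal: "Ga_endo Const \<phi> Var i \<in> kernel_ideal \<phi>"
  unfolding kernel_ideal_def by (rule ideal.span_base) simp

lemma kernel_ideal_add_row_subset: "kernel_ideal (add_row i j a \<phi>) \<subseteq> kernel_ideal \<phi>"
proof -
  have "Ga_endo Const (add_row i j a \<phi>) Var r \<in> ideal.span (range (Ga_endo Const \<phi> Var))" for r
    by (simp add: Ga_endo_add_row[OF algebra_structure_Const] ideal.span_add ideal.span_base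
        sp_act_in_ideal[OF algebra_structure_Const])
  then show ?thesis
    unfolding kernel_ideal_def by (intro ideal.span_minimal) auto
qed

text \<open>A row operation with \<open>a\<close> is undone by the one with \<open>- a\<close>, so
  the inclusion for a single operation gives equality.\<close>

lemma kernel_ideal_row_equiv:
  fixes \<phi> :: "'k::field_prime_char skew_poly ^ 'n ^ 'n"
  assumes "row_equiv A \<phi> \<psi>"
  shows "kernel_ideal \<psi> = kernel_ideal \<phi>"
  using assms
proof induction
  case (add_row N i j a)
  have "kernel_ideal N \<subseteq> kernel_ideal (add_row i j a N)"
    using kernel_ideal_add_row_subset[of i j "- a" "add_row i j a N"] add_row_uminus[of i j a N] add_row
    by simp
  with add_row kernel_ideal_add_row_subset[of i j a N] show ?case by blast
qed simp

lemma points_kernel_ideal: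
  fixes \<eta> :: "'k::field_prime_char \<Rightarrow> 'a::comm_ring_1" and \<phi> :: "'k skew_poly ^ 'n ^ 'n"
  assumes "algebra_structure \<eta>"
  shows "points \<eta> (kernel_ideal \<phi>) = {x. \<forall>i. Ga_endo \<eta> \<phi> x i = 0}"
proof -
  have "mpoly_eval \<eta> x f = 0" if "\<forall>i. Ga_endo \<eta> \<phi> x i = 0" "f \<in> kernel_ideal \<phi>" for x f
  proof -
    \<comment> \<open>The span of the empty set is the zero ideal, which turns vanishing into an
      instance of ideal membership.\<close>
    have "mpoly_eval \<eta> x f \<in> ideal.span {}"
      using that(2) unfolding kernel_ideal_def
      by (rule ideal_span_hom_image[rotated -1])
        (use that(1) in \<open>auto simp: mpoly_eval_add[OF assms] mpoly_eval_mult[OF assms]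
          mpoly_eval_Ga_endo_Var[OF assms]\<close>)
    then show ?thesis by simp
  qed
  then show ?thesis
    unfolding points_def
    using Ga_endo_in_kernel_ideal[of \<phi>] mpoly_eval_Ga_endo_Var[OF assms, of _ \<phi>] by fastforce
qed

text \<open>Additivity of \<phi>, applied to the two universal points and to the negative of the
  universal point, shows that comultiplication sends a generator \<open>s\<close> to the sum of its
  two copies and the antipode sends it to \<open>- s\<close>.\<close>

lemma closed_subgroup_scheme_kernel_ideal:
  fixes \<phi> :: "'k::field_prime_char skew_poly ^ 'n ^ 'n"
  shows "closed_subgroup_scheme (kernel_ideal \<phi>)"
  unfolding closed_subgroup_scheme_def
proof (intro conjI ballI)
  note C = algebra_structure_Const
  show "ideal.subspace (kernel_ideal \<phi>)"
    unfolding kernel_ideal_def by (rule ideal.subspace_span)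
  fix f assume f: "f \<in> kernel_ideal \<phi>"
  let ?l = "\<lambda>i. Var (Inl i) :: ('n + 'n, 'k) mpoly" and ?r = "\<lambda>i. Var (Inr i) :: ('n + 'n, 'k) mpoly"
  let ?U = "mpoly_eval Const ?l ` kernel_ideal \<phi> \<union> mpoly_eval Const ?r ` kernel_ideal \<phi>"
  show "mpoly_eval Const (\<lambda>i. ?l i + ?r i) f \<in> ideal.span ?U"
  proof (rule ideal_span_hom_image[OF _ _ _ f[unfolded kernel_ideal_def]])
    fix s assume "s \<in> range (Ga_endo Const \<phi> Var)"
    then obtain i where s: "s = Ga_endo Const \<phi> Var i" by blast
    have "mpoly_eval Const (\<lambda>i. ?l i + ?r i) s = mpoly_eval Const ?l s + mpoly_eval Const ?r s"
      unfolding s mpoly_eval_Ga_endo_Var[OF C] by (rule Ga_endo_add[OF C])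
    moreover have "s \<in> kernel_ideal \<phi>" unfolding s by (rule Ga_endo_in_kernel_ideal)
    ultimately show "mpoly_eval Const (\<lambda>i. ?l i + ?r i) s \<in> ideal.span ?U"
      by (simp add: ideal.span_add ideal.span_base)
  qed (simp_all add: mpoly_eval_add[OF C] mpoly_eval_mult[OF C])
  \<comment> \<open>The counit is evaluation at the origin, which is a point of the kernel over the
    base field.\<close>
  show "mpoly_eval id (\<lambda>_. 0) f = 0"
    using f points_kernel_ideal[OF algebra_structure_id, of \<phi>] Ga_endo_0[OF algebra_structure_id, of \<phi>]
    by (auto simp: points_def)
  show "mpoly_eval Const (\<lambda>i. - Var i) f \<in> kernel_ideal \<phi>"
    unfolding kernel_ideal_def
  proof (rule ideal_span_hom_image[OF _ _ _ f[unfolded kernel_ideal_def]])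
    fix s assume "s \<in> range (Ga_endo Const \<phi> Var)"
    then obtain i where s: "s = Ga_endo Const \<phi> Var i" by blast
    show "mpoly_eval Const (\<lambda>i. - Var i) s \<in> ideal.span (range (Ga_endo Const \<phi> Var))"
      unfolding s mpoly_eval_Ga_endo_Var[OF C] Ga_endo_uminus[OF C]
      by (intro ideal.span_neg ideal.span_base) simp
  qed (simp_all add: mpoly_eval_add[OF C] mpoly_eval_mult[OF C])
qed

section \<open>The rank of a triangular system\<close>

lift_definition filter_keys :: "('a \<Rightarrow> bool) \<Rightarrow> ('a \<Rightarrow>\<^sub>0 'b::zero) \<Rightarrow> 'a \<Rightarrow>\<^sub>0 'b"
  is "\<lambda>P f k. if P k then f k else 0"
proof -
  fix P :: "'a \<Rightarrow> bool" and f :: "'a \<Rightarrow> 'b"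
  assume "finite {k. f k \<noteq> 0}"
  then show "finite {k. (if P k then f k else 0) \<noteq> 0}"
    by (rule rev_finite_subset) auto
qed

lemma keys_filter_keys: "Poly_Mapping.keys (filter_keys P f) = {k \<in> Poly_Mapping.keys f. P k}"
  by (auto simp: in_keys_iff filter_keys.rep_eq split: if_splits)

lemma filter_keys_0: "filter_keys P 0 = 0"
  by (rule poly_mapping_eqI) (simp add: filter_keys.rep_eq)

lemma filter_keys_add: "filter_keys P (f + g) = filter_keys P f + filter_keys P g"
  by (rule poly_mapping_eqI) (simp add: filter_keys.rep_eq lookup_add)

lemma filter_keys_diff:
  fixes f :: "'a \<Rightarrow>\<^sub>0 'b::ab_group_add"
  shows "filter_keys P (f - g) = filter_keys P f - filter_keys P g"
  by (rule poly_mapping_eqI) (simp add: filter_keys.rep_eq lookup_minus)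

lemma filter_keys_id: "(\<And>k. k \<in> Poly_Mapping.keys f \<Longrightarrow> P k) \<Longrightarrow> filter_keys P f = f"
  by (rule poly_mapping_eqI) (auto simp: filter_keys.rep_eq in_keys_iff)

lemma filter_keys_eq_0: "(\<And>k. k \<in> Poly_Mapping.keys f \<Longrightarrow> \<not> P k) \<Longrightarrow> filter_keys P f = 0"
  by (rule poly_mapping_eqI) (auto simp: filter_keys.rep_eq in_keys_iff)

text \<open>Multiplication by a polynomial free of \<open>x_i\<close> preserves exponents of
  \<open>x_i\<close>, so selecting monomials by this exponent is linear over such
  polynomials.\<close>

lemma filter_keys_mult:
  fixes h f :: "('n, 'k::comm_ring_1) mpoly"
  assumes "\<And>k. k \<in> Poly_Mapping.keys f \<Longrightarrow> Poly_Mapping.lookup k i = 0"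
  shows "filter_keys (\<lambda>k. Q (Poly_Mapping.lookup k i)) (h * f)
    = filter_keys (\<lambda>k. Q (Poly_Mapping.lookup k i)) h * f"
proof (induction h rule: poly_mapping_single_induct)
  case (single m c)
  have "Poly_Mapping.lookup k i = Poly_Mapping.lookup m i"
    if "k \<in> Poly_Mapping.keys (Poly_Mapping.single m c * f)" for k
    using that keys_mult[of "Poly_Mapping.single m c" f] assms by (auto simp: lookup_add split: if_splits)
  then have "filter_keys (\<lambda>k. Q (Poly_Mapping.lookup k i)) (Poly_Mapping.single m c * f)
      = (if Q (Poly_Mapping.lookup m i) then Poly_Mapping.single m c * f else 0)"
    by (auto intro!: filter_keys_id filter_keys_eq_0)
  moreover have "filter_keys (\<lambda>k. Q (Poly_Mapping.lookup k i)) (Poly_Mapping.single m c)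
      = (if Q (Poly_Mapping.lookup m i) then Poly_Mapping.single m c else 0)"
    by (auto intro!: filter_keys_id filter_keys_eq_0 split: if_splits)
  ultimately show ?case by simp
qed (simp add: distrib_right filter_keys_add)

lemma lookup_mult_single:
  fixes f :: "'a::cancel_comm_monoid_add \<Rightarrow>\<^sub>0 'b::comm_semiring_1"
  shows "Poly_Mapping.lookup (f * Poly_Mapping.single k c) (l + k) = Poly_Mapping.lookup f l * c"
proof (induction f rule: poly_mapping_single_induct)
  case (single m d)
  show ?case by (simp add: mult_single lookup_single when_def)
qed (simp add: distrib_right lookup_add)

text \<open>An ideal with generators free of \<open>x_i\<close> is homogeneous for the grading by
  degree in \<open>x_i\<close>.\<close>

lemma filter_keys_ideal:
  fixes S :: "('n, 'k::comm_ring_1) mpoly set"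
  assumes S: "\<And>s k. s \<in> S \<Longrightarrow> k \<in> Poly_Mapping.keys s \<Longrightarrow> Poly_Mapping.lookup k i = 0"
    and f: "f \<in> ideal.span S"
  shows "filter_keys (\<lambda>k. Q (Poly_Mapping.lookup k i)) f \<in> ideal.span S"
  using f
proof (induction rule: ideal.span_induct_alt)
  case base
  show ?case by (simp add: filter_keys_0 ideal.span_zero)
next
  case (step c x y)
  then show ?case
    by (simp add: filter_keys_add filter_keys_mult[OF S] ideal.span_add ideal.span_scale ideal.span_base)
qed

section \<open>Normal forms modulo a triangular system\<close>

definition reduced_mpolys :: "('n \<Rightarrow> nat) \<Rightarrow> 'n set \<Rightarrow> ('n, 'k::zero) mpoly set" where
  "reduced_mpolys N S = {g. \<forall>k\<in>Poly_Mapping.keys g. \<forall>i\<in>S. Poly_Mapping.lookup k i < N i}"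

lemma reduced_mpolys_add: "f \<in> reduced_mpolys N S \<Longrightarrow> g \<in> reduced_mpolys N S \<Longrightarrow> f + g \<in> reduced_mpolys N S"
  using keys_add[of f g] by (auto simp: reduced_mpolys_def)

lemma reduced_mpolys_0: "0 \<in> reduced_mpolys N S"
  by (simp add: reduced_mpolys_def)

text \<open>One elimination step. \<open>F c\<close> has the leading term \<open>a x_c^(N c)\<close>
  as a polynomial in \<open>x_c\<close>, with \<open>a\<close> a unit, while the generators indexed
  by \<open>S\<close> are free of \<open>x_c\<close>. The assumptions \<open>ex\<close> and
  \<open>un\<close> say that the reduced polynomials for \<open>S\<close> are a complement of the
  ideal of these generators; both properties are carried over to \<open>insert c S\<close>.\<close>

context
  fixes a :: "'k::field" and N :: "'n::finite \<Rightarrow> nat" and c :: 'n and S :: "'n set"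
    and F :: "'n \<Rightarrow> ('n, 'k) mpoly" and G :: "('n, 'k) mpoly"
  assumes a: "a \<noteq> 0" and c: "c \<notin> S"
    and F: "F c = Poly_Mapping.single (Poly_Mapping.single c (N c)) a + G"
    and G: "\<And>k. k \<in> Poly_Mapping.keys G \<Longrightarrow> Poly_Mapping.lookup k c < N c"
    and S: "\<And>i k. i \<in> S \<Longrightarrow> k \<in> Poly_Mapping.keys (F i) \<Longrightarrow> Poly_Mapping.lookup k c = 0"
    and ex: "\<And>g. \<exists>v\<in>reduced_mpolys N S. g - v \<in> ideal.span (F ` S)"
    and un: "reduced_mpolys N S \<inter> ideal.span (F ` S) = {0}"
begin

lemma filter_keys_span:
  "f \<in> ideal.span (F ` S) \<Longrightarrow> filter_keys (\<lambda>k. Q (Poly_Mapping.lookup k c)) f \<in> ideal.span (F ` S)"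
  by (rule filter_keys_ideal) (use S in auto)

lemma reduced_insert_ideal_eq_0:
  assumes g: "g \<in> reduced_mpolys N (insert c S)" "g \<in> ideal.span (F ` insert c S)"
  shows "g = 0"
proof -
  let ?I = "ideal.span (F ` S)"
  obtain q0 where q0: "g - q0 * F c \<in> ?I"
    using g(2) by (auto simp: ideal.span_breakdown_eq)
  \<comment> \<open>Passing to a reduced \<open>q\<close> changes the multiple of \<open>F c\<close>
    only within \<open>?I\<close>, and makes \<open>un\<close> applicable to parts of
    \<open>q\<close>.\<close>
  obtain q where q: "q \<in> reduced_mpolys N S" "q0 - q \<in> ?I"
    using ex by blast
  define h where "h = g - q * F c"
  have "h = (g - q0 * F c) + F c * (q0 - q)"
    by (simp add: h_def algebra_simps)
  then have h: "h \<in> ?I"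
    using q0 q(2) by (simp add: ideal.span_add ideal.span_scale)
  \<comment> \<open>If \<open>e\<close> is the degree of \<open>q \<noteq> 0\<close> in \<open>x\<^sub>c\<close>, the part of \<open>h\<close> of degree \<open>e + N c\<close> in \<open>x\<^sub>c\<close> is
    \<open>- a x\<^sub>c\<^bsup>N c\<^esup>\<close> times the degree \<open>e\<close> part of \<open>q\<close>: nonzero, reduced, and in the ideal.\<close>
  have "q = 0"
  proof (rule ccontr)
    assume "q \<noteq> 0"
    then have ne: "Poly_Mapping.keys q \<noteq> {}" by simp
    define e where "e = Max ((\<lambda>k. Poly_Mapping.lookup k c) ` Poly_Mapping.keys q)"
    have "e \<in> (\<lambda>k. Poly_Mapping.lookup k c) ` Poly_Mapping.keys q"
      unfolding e_def using ne by (intro Max_in) auto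
    then obtain k where k: "k \<in> Poly_Mapping.keys q" "Poly_Mapping.lookup k c = e" by blast
    have le: "Poly_Mapping.lookup l c \<le> e" if "l \<in> Poly_Mapping.keys q" for l
      unfolding e_def using that by (intro Max_ge) auto
    let ?P = "filter_keys (\<lambda>k. Poly_Mapping.lookup k c = e + N c) :: ('n, 'k) mpoly \<Rightarrow> _"
    let ?s = "Poly_Mapping.single (Poly_Mapping.single c (N c)) a"
    \<comment> \<open>Neither \<open>g\<close> nor \<open>q * G\<close> reaches the exponent
      \<open>e + N c\<close> of \<open>x_c\<close>: in \<open>g\<close> it stays below
      \<open>N c\<close>, and in \<open>q * G\<close> it is at most \<open>e\<close> plus something
      below \<open>N c\<close>.\<close>
    have "?P g = 0"
      by (rule filter_keys_eq_0) (use g(1) in \<open>force simp: reduced_mpolys_def\<close>)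
    moreover have "?P (q * G) = 0"
      by (rule filter_keys_eq_0) (use keys_mult[of q G] le G in \<open>fastforce simp: lookup_add\<close>)
    ultimately have "?P h = 0 - ?P (q * ?s)"
      by (simp add: h_def F distrib_left filter_keys_diff filter_keys_add)
    moreover have "?P h \<in> ?I"
      by (rule filter_keys_span[OF h])
    ultimately have "?P (q * ?s) \<in> ?I"
      using ideal.span_neg by fastforce
    moreover have "?P (q * ?s) \<in> reduced_mpolys N S"
    proof -
      have "Poly_Mapping.lookup l i < N i" if l: "l \<in> Poly_Mapping.keys (q * ?s)" and i: "i \<in> S" for l i
      proof -
        obtain b where "b \<in> Poly_Mapping.keys q" "l = b + Poly_Mapping.single c (N c)"
          using l keys_mult[of q ?s] by (auto split: if_splits)
        moreover have "i \<noteq> c" using i c by blast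
        ultimately show ?thesis
          using q(1) i by (auto simp: reduced_mpolys_def lookup_add lookup_single)
      qed
      then show ?thesis by (auto simp: reduced_mpolys_def keys_filter_keys)
    qed
    ultimately have "?P (q * ?s) = 0" using un by blast
    then have "Poly_Mapping.lookup (?P (q * ?s)) (k + Poly_Mapping.single c (N c)) = 0" by simp
    then show False
      using k a by (simp add: filter_keys.rep_eq lookup_add lookup_mult_single in_keys_iff)
  qed
  then have "g \<in> ?I" using h by (simp add: h_def)
  moreover have "g \<in> reduced_mpolys N S" using g(1) by (auto simp: reduced_mpolys_def)
  ultimately show ?thesis using un by blast
qed

text \<open>By additivity monomials suffice, and these are treated by induction on the exponent of
  \<open>x_c\<close>. If it is below \<open>N c\<close>, reduction modulo the generators for
  \<open>S\<close> is enough; otherwise \<open>F c\<close> is used to lower it.\<close>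

lemma reduced_insert_exists: "\<exists>v\<in>reduced_mpolys N (insert c S). g - v \<in> ideal.span (F ` insert c S)"
proof -
  let ?J = "ideal.span (F ` insert c S)"
  define W where "W = {g. \<exists>v\<in>reduced_mpolys N (insert c S). g - v \<in> ?J}"
  have zero: "0 \<in> W"
    by (auto simp: W_def ideal.span_zero intro: bexI[OF _ reduced_mpolys_0])
  have add: "f + g \<in> W" if fg: "f \<in> W" "g \<in> W" for f g
  proof -
    obtain v w where "v \<in> reduced_mpolys N (insert c S)" "f - v \<in> ?J" "w \<in> reduced_mpolys N (insert c S)" "g - w \<in> ?J"
      using fg by (auto simp: W_def)
    moreover have "f + g - (v + w) = (f - v) + (g - w)" by simp
    ultimately show ?thesis
      unfolding W_def using ideal.span_add reduced_mpolys_add by (metis (mono_tags, lifting) mem_Collect_eq)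
  qed
  have sum: "(\<Sum>x\<in>A. f x) \<in> W" if "\<And>x. x \<in> A \<Longrightarrow> f x \<in> W" for A and f :: "('n \<Rightarrow>\<^sub>0 nat) \<Rightarrow> _"
    using that
    by (induction A rule: infinite_finite_induct) (simp_all add: zero add)
  have mono: "ideal.span (F ` S) \<subseteq> ?J"
    by (intro ideal.span_mono) auto
  have "Poly_Mapping.single k d \<in> W" for k d
  proof (induction "Poly_Mapping.lookup k c" arbitrary: k d rule: less_induct)
    case less
    show ?case
    proof (cases "Poly_Mapping.lookup k c < N c")
      case True
      obtain v where v: "v \<in> reduced_mpolys N S" "Poly_Mapping.single k d - v \<in> ideal.span (F ` S)"
        using ex by blast
      \<comment> \<open>The normal form \<open>v\<close> might contain high powers of
        \<open>x_c\<close>. Truncation removes them and leaves the congruence intact, as the ideal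
        of \<open>S\<close> is homogeneous in \<open>x_c\<close>.\<close>
      let ?P = "filter_keys (\<lambda>k. Poly_Mapping.lookup k c < N c) :: ('n, 'k) mpoly \<Rightarrow> _"
      have "?P (Poly_Mapping.single k d) = Poly_Mapping.single k d"
        by (rule filter_keys_id) (use True in \<open>simp split: if_splits\<close>)
      moreover have "?P (Poly_Mapping.single k d - v) \<in> ideal.span (F ` S)"
        by (rule filter_keys_span[OF v(2)])
      ultimately have "Poly_Mapping.single k d - ?P v \<in> ?J"
        using mono by (auto simp: filter_keys_diff)
      moreover have "?P v \<in> reduced_mpolys N (insert c S)"
        using v(1) by (auto simp: reduced_mpolys_def keys_filter_keys)
      ultimately show ?thesis by (auto simp: W_def)
    next
      case False
      define k' where "k' = k - Poly_Mapping.single c (N c)"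
      have k: "k = k' + Poly_Mapping.single c (N c)"
        using False by (intro poly_mapping_eqI) (auto simp: k'_def lookup_add lookup_minus lookup_single when_def)
      \<comment> \<open>\<open>R\<close> arises from the monomial by substituting
        \<open>- G / a\<close> for a factor \<open>x_c^(N c)\<close>.\<close>
      define R where "R = Poly_Mapping.single k' (- (d / a)) * G"
      have "R \<in> W"
      proof (subst poly_mapping_eq_sum_single, rule sum, rule less)
        fix l assume "l \<in> Poly_Mapping.keys R"
        then obtain b where "b \<in> Poly_Mapping.keys G" "l = k' + b"
          unfolding R_def using keys_mult[of _ G] by (fastforce split: if_splits)
        then show "Poly_Mapping.lookup l c < Poly_Mapping.lookup k c"
          using G by (simp add: k lookup_add)
      qed
      then obtain v where v: "v \<in> reduced_mpolys N (insert c S)" "R - v \<in> ?J" by (auto simp: W_def)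
      have "Poly_Mapping.single k d - R = Poly_Mapping.single k' (d / a) * F c"
        using a by (simp add: R_def F distrib_left mult_single k single_uminus)
      then have "Poly_Mapping.single k d - R \<in> ?J"
        by (simp add: ideal.span_scale ideal.span_base)
      then have "(Poly_Mapping.single k d - R) + (R - v) \<in> ?J"
        using v(2) by (rule ideal.span_add)
      then show ?thesis using v(1) by (auto simp: W_def)
    qed
  qed
  then have "g \<in> W"
    by (subst poly_mapping_eq_sum_single) (rule sum)
  then show ?thesis by (simp add: W_def)
qed

end

text \<open>The variables are added in decreasing order of \<open>f\<close>. The generators already
  present involve only later variables, so they are free of the new one, as the elimination step
  requires.\<close>

lemma triangular_reduced:
  fixes F G :: "'n::finite \<Rightarrow> ('n, 'k::field) mpoly" and f :: "'n \<Rightarrow> nat"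
  assumes f: "inj f" and a: "\<And>i. a i \<noteq> 0"
    and F: "\<And>i. F i = Poly_Mapping.single (Poly_Mapping.single i (N i)) (a i) + G i"
    and G: "\<And>i k. k \<in> Poly_Mapping.keys (G i) \<Longrightarrow> Poly_Mapping.lookup k i < N i"
    and G0: "\<And>i j k. k \<in> Poly_Mapping.keys (G i) \<Longrightarrow> f j < f i \<Longrightarrow> Poly_Mapping.lookup k j = 0"
  shows "(\<forall>g. \<exists>v\<in>reduced_mpolys N UNIV. g - v \<in> ideal.span (range F)) \<and>
    reduced_mpolys N UNIV \<inter> ideal.span (range F) = {0}"
proof -
  define n where "n = Suc (Max (range f))"
  have n: "f i < n" for i
    unfolding n_def by (simp add: less_Suc_eq_le)
  have F0: "Poly_Mapping.lookup k j = 0" if "f j < f i" "k \<in> Poly_Mapping.keys (F i)" for i j k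
  proof -
    have "k = Poly_Mapping.single i (N i) \<or> k \<in> Poly_Mapping.keys (G i)"
      using that(2) keys_add unfolding F by (fastforce split: if_splits)
    then show ?thesis using that(1) G0 by (auto simp: lookup_single when_def)
  qed
  have "(\<forall>g. \<exists>v\<in>reduced_mpolys N {i. m \<le> f i}. g - v \<in> ideal.span (F ` {i. m \<le> f i})) \<and>
    reduced_mpolys N {i. m \<le> f i} \<inter> ideal.span (F ` {i. m \<le> f i}) = {0}" if "m \<le> n" for m
    using that
  proof (induction m rule: inc_induct)
    \<comment> \<open>Without generators the ideal is zero and every polynomial is its own normal
      form.\<close>
    case base
    have "{i. n \<le> f i} = {}" using n by (auto simp: not_le)
    then show ?case by (auto simp: reduced_mpolys_def intro: exI[of _ g for g])
  next
    case (step m)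
    show ?case
    proof (cases "\<exists>c. f c = m")
      case False
      then have "{i. m \<le> f i} = {i. Suc m \<le> f i}"
        by (auto simp: Suc_le_eq le_less)
      then show ?thesis using step by simp
    next
      case True
      then obtain c where c: "f c = m" by blast
      have S: "{i. m \<le> f i} = insert c {i. Suc m \<le> f i}"
        using c inj_eq[OF f] by (auto simp: Suc_le_eq le_less)
      have c': "c \<notin> {i. Suc m \<le> f i}" using c by simp
      have 0: "Poly_Mapping.lookup k c = 0" if "i \<in> {i. Suc m \<le> f i}" "k \<in> Poly_Mapping.keys (F i)" for i k
        using that F0[of c i k] c by simp
      have ex: "\<exists>v\<in>reduced_mpolys N {i. Suc m \<le> f i}. g - v \<in> ideal.span (F ` {i. Suc m \<le> f i})" for g
        using step by blast
      have un: "reduced_mpolys N {i. Suc m \<le> f i} \<inter> ideal.span (F ` {i. Suc m \<le> f i}) = {0}"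
        using step by blast
      show ?thesis
      proof (intro conjI allI)
        fix g
        show "\<exists>v\<in>reduced_mpolys N {i. m \<le> f i}. g - v \<in> ideal.span (F ` {i. m \<le> f i})"
          unfolding S by (rule reduced_insert_exists[OF a c' F _ _ ex un]) (use G 0 in blast)+
        have "g = 0" if "g \<in> reduced_mpolys N {i. m \<le> f i}" "g \<in> ideal.span (F ` {i. m \<le> f i})" for g
          using that unfolding S
          by (rule reduced_insert_ideal_eq_0[OF a c' F _ _ ex un, rotated 2]) (use G 0 in blast)+
        then show "reduced_mpolys N {i. m \<le> f i} \<inter> ideal.span (F ` {i. m \<le> f i}) = {0}"
          using reduced_mpolys_0 ideal.span_zero by blast
      qed
    qed
  qed
  from this[of 0] show ?thesis by simp
qed

section \<open>Monomial bases of quotients\<close>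

lemma card_bounded_exponents:
  fixes N :: "'n::finite \<Rightarrow> nat"
  shows "finite {k. \<forall>i. Poly_Mapping.lookup k i < N i}"
    and "card {k. \<forall>i. Poly_Mapping.lookup k i < N i} = (\<Prod>i\<in>UNIV. N i)"
proof -
  have "bij_betw Poly_Mapping.lookup {k. \<forall>i. Poly_Mapping.lookup k i < N i} (\<Pi>\<^sub>E i\<in>UNIV. {..<N i})"
  proof (rule bij_betwI')
    fix x assume "x \<in> (\<Pi>\<^sub>E i\<in>UNIV. {..<N i})"
    \<comment> \<open>Over a finite index type every function has finite support, so
      \<open>Abs_poly_mapping\<close> applies.\<close>
    then show "\<exists>k\<in>{k. \<forall>i. Poly_Mapping.lookup k i < N i}. x = Poly_Mapping.lookup k"
      by (intro bexI[of _ "Abs_poly_mapping x"]) (auto simp: PiE_def Pi_def)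
  next
    fix k l :: "'n \<Rightarrow>\<^sub>0 nat"
    show "(Poly_Mapping.lookup k = Poly_Mapping.lookup l) = (k = l)"
      by (simp only: poly_mapping_eq_iff)
  next
    fix k assume "k \<in> {k. \<forall>i. Poly_Mapping.lookup k i < N i}"
    then show "Poly_Mapping.lookup k \<in> (\<Pi>\<^sub>E i\<in>UNIV. {..<N i})"
      by (simp add: PiE_UNIV_domain)
  qed
  moreover have "finite (\<Pi>\<^sub>E i\<in>UNIV. {..<N i})" by (intro finite_PiE) auto
  ultimately show "finite {k. \<forall>i. Poly_Mapping.lookup k i < N i}"
    "card {k. \<forall>i. Poly_Mapping.lookup k i < N i} = (\<Prod>i\<in>UNIV. N i)"
    by (simp_all add: bij_betw_finite bij_betw_same_card card_PiE)
qed

lemma finite_of_rank_reduced: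
  fixes I :: "('n::finite, 'k::field) mpoly set"
  assumes I: "ideal.subspace I" and ex: "\<And>g. \<exists>v\<in>reduced_mpolys N UNIV. g - v \<in> I"
    and un: "reduced_mpolys N UNIV \<inter> I = {0}"
  shows "finite_of_rank I (\<Prod>i\<in>UNIV. N i)"
proof -
  define K where "K = {k. \<forall>i. Poly_Mapping.lookup k i < N i}"
  define mon :: "('n \<Rightarrow>\<^sub>0 nat) \<Rightarrow> ('n, 'k) mpoly" where "mon = (\<lambda>k. Poly_Mapping.single k 1)"
  have inj: "inj mon"
    unfolding mon_def by (rule injI) (metis lookup_single_eq lookup_single_not_eq zero_neq_one)
  have fin: "finite K" and card: "card K = (\<Prod>i\<in>UNIV. N i)"
    using card_bounded_exponents by (auto simp: K_def)
  have sum_eq: "(\<Sum>b\<in>mon ` K. Const (c b) * b) = (\<Sum>k\<in>K. Poly_Mapping.single k (c (mon k)))" for c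
    unfolding sum.reindex[OF inj_on_subset[OF inj subset_UNIV]]
    by (simp add: mon_def Const_def mult_single)
  have lookup: "Poly_Mapping.lookup (\<Sum>k\<in>K. Poly_Mapping.single k (w k)) l = (if l \<in> K then w l else 0)"
    for w :: "_ \<Rightarrow> 'k" and l
    using fin by (simp add: lookup_sum lookup_single when_def)
  have red: "v \<in> reduced_mpolys N UNIV \<longleftrightarrow> Poly_Mapping.keys v \<subseteq> K" for v :: "('n, 'k) mpoly"
    by (auto simp: reduced_mpolys_def K_def)
  show ?thesis
    unfolding finite_of_rank_def
  proof (intro exI[of _ "mon ` K"] conjI allI)
    show "finite (mon ` K)" using fin by simp
    show "card (mon ` K) = (\<Prod>i\<in>UNIV. N i)"
      using card card_image[OF inj_on_subset[OF inj]] by simp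
    fix g
    obtain v where v: "v \<in> reduced_mpolys N UNIV" "g - v \<in> I" using ex by blast
    \<comment> \<open>Coefficient families are indexed by basis elements, not by exponents, hence
      the inverse of \<open>mon\<close>; the value 0 outside the basis is prescribed.\<close>
    define c where "c = (\<lambda>b. if b \<in> mon ` K then Poly_Mapping.lookup v (inv mon b) else 0)"
    have "(\<Sum>k\<in>K. Poly_Mapping.single k (c (mon k))) = v"
      using v(1) by (intro poly_mapping_eqI)
        (auto simp: lookup c_def inv_f_f[OF inj] red in_keys_iff)
    then have c: "g - (\<Sum>b\<in>mon ` K. Const (c b) * b) \<in> I"
      using v(2) by (simp add: sum_eq)
    show "\<exists>!c. (\<forall>b. b \<notin> mon ` K \<longrightarrow> c b = 0) \<and> g - (\<Sum>b\<in>mon ` K. Const (c b) * b) \<in> I"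
    proof (rule ex1I[of _ c])
      show "(\<forall>b. b \<notin> mon ` K \<longrightarrow> c b = 0) \<and> g - (\<Sum>b\<in>mon ` K. Const (c b) * b) \<in> I"
        using c by (simp add: c_def)
    next
      fix c' assume c': "(\<forall>b. b \<notin> mon ` K \<longrightarrow> c' b = 0) \<and> g - (\<Sum>b\<in>mon ` K. Const (c' b) * b) \<in> I"
      \<comment> \<open>Two expansions of \<open>g\<close> differ by an element that is both reduced
        and in \<open>I\<close>, hence by zero.\<close>
      have "(g - (\<Sum>k\<in>K. Poly_Mapping.single k (c (mon k)))) - (g - (\<Sum>k\<in>K. Poly_Mapping.single k (c' (mon k)))) \<in> I"
        using c c' by - (rule ideal.subspace_diff[OF I], simp_all add: sum_eq)
      moreover have "(g - (\<Sum>k\<in>K. Poly_Mapping.single k (c (mon k)))) - (g - (\<Sum>k\<in>K. Poly_Mapping.single k (c' (mon k))))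
          = (\<Sum>k\<in>K. Poly_Mapping.single k (c' (mon k) - c (mon k)))"
        by (simp add: single_diff sum_subtractf)
      moreover have "(\<Sum>k\<in>K. Poly_Mapping.single k (c' (mon k) - c (mon k))) \<in> reduced_mpolys N UNIV"
        unfolding red by (auto simp: in_keys_iff lookup split: if_splits)
      ultimately have "(\<Sum>k\<in>K. Poly_Mapping.single k (c' (mon k) - c (mon k))) = 0"
        using un by auto
      then have "c' (mon k) = c (mon k)" if "k \<in> K" for k
        using lookup[of "\<lambda>k. c' (mon k) - c (mon k)" k] that by simp
      then show "c' = c"
        using c' by (auto simp: fun_eq_iff c_def)
    qed
  qed
qed

text \<open>An entry of the matrix contributes only pure powers of one variable, so zeros of the
  matrix translate into absent variables.\<close>

lemma sp_act_Const_Var: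
  fixes r :: "'k::field_prime_char skew_poly" and j :: "'n::finite"
  shows "sp_act Const r (Var j :: ('n, 'k) mpoly) =
     (\<Sum>m\<le>sp_degree r. Poly_Mapping.single (Poly_Mapping.single j (CHAR('k) ^ m)) (sp_coeff r m))"
proof -
  have "(Var j :: ('n, 'k) mpoly) ^ n = Poly_Mapping.single (Poly_Mapping.single j n) 1" for n
    by (induction n) (simp_all add: Var_def mult_single single_add[symmetric])
  then show ?thesis
    by (simp add: sp_act_def Const_def mult_single)
qed

text \<open>The top coefficient of the diagonal entry gives the leading term of the
  \<open>i\<close>-th generator. Off-diagonal entries may have any degree, because they involve
  later variables only.\<close>

lemma finite_of_rank_triangular:
  fixes T :: "'k::field_prime_char skew_poly ^ 'n ^ 'n" and f :: "'n \<Rightarrow> nat"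
  assumes f: "inj f" and T: "\<And>i j. f j < f i \<Longrightarrow> T $ i $ j = 0" and nz: "\<And>i. T $ i $ i \<noteq> 0"
  shows "finite_of_rank (kernel_ideal T) (CHAR('k) ^ (\<Sum>i\<in>UNIV. sp_degree (T $ i $ i)))"
proof -
  define d where "d = (\<lambda>i. sp_degree (T $ i $ i))"
  define N where "N = (\<lambda>i. CHAR('k) ^ d i)"
  define F where "F = (Ga_endo Const T Var :: 'n \<Rightarrow> ('n, 'k) mpoly)"
  define G where "G = (\<lambda>i. (\<Sum>m<d i. Poly_Mapping.single (Poly_Mapping.single i (CHAR('k) ^ m)) (sp_coeff (T $ i $ i) m))
    + (\<Sum>j\<in>UNIV - {i}. sp_act Const (T $ i $ j) (Var j)) :: ('n, 'k) mpoly)"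
  have F: "F i = Poly_Mapping.single (Poly_Mapping.single i (N i)) (sp_coeff (T $ i $ i) (d i)) + G i" for i
  proof -
    have "F i = sp_act Const (T $ i $ i) (Var i) + (\<Sum>j\<in>UNIV - {i}. sp_act Const (T $ i $ j) (Var j))"
      unfolding F_def Ga_endo_eq by (rule sum.remove) auto
    then show ?thesis
      by (simp add: sp_act_Const_Var[of _ i] G_def N_def d_def lessThan_Suc_atMost[symmetric] ac_simps)
  qed
  have p: "prime CHAR('k)" by simp
  \<comment> \<open>This makes \<open>p^m\<close> strictly smaller than \<open>p^(d i)\<close> for
    \<open>m < d i\<close>.\<close>
  then have p1: "1 < CHAR('k)" by (rule prime_gt_1_nat)
  have G: "(\<exists>m<d i. k = Poly_Mapping.single i (CHAR('k) ^ m)) \<or>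
      (\<exists>j m. j \<noteq> i \<and> \<not> f j < f i \<and> k = Poly_Mapping.single j (CHAR('k) ^ m))"
    if k: "k \<in> Poly_Mapping.keys (G i)" for i k
  proof -
    consider "k \<in> Poly_Mapping.keys (\<Sum>m<d i. Poly_Mapping.single (Poly_Mapping.single i (CHAR('k) ^ m)) (sp_coeff (T $ i $ i) m))"
      | "k \<in> Poly_Mapping.keys (\<Sum>j\<in>UNIV - {i}. sp_act Const (T $ i $ j) (Var j) :: ('n, 'k) mpoly)"
      using subsetD[OF keys_add k[unfolded G_def]] by blast
    then show ?thesis
    proof cases
      case 1
      then show ?thesis using subsetD[OF keys_sum 1] by (auto split: if_splits)
    next
      case 2
      then obtain j where j: "j \<noteq> i" "k \<in> Poly_Mapping.keys (sp_act Const (T $ i $ j) (Var j) :: ('n, 'k) mpoly)"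
        using subsetD[OF keys_sum 2] by blast
      then have "\<not> f j < f i"
        using T[of j i] by (auto simp: sp_act_0_left[OF algebra_structure_Const])
      moreover have "\<exists>m. k = Poly_Mapping.single j (CHAR('k) ^ m)"
        using subsetD[OF keys_sum j(2)[unfolded sp_act_Const_Var]] by (auto split: if_splits)
      ultimately show ?thesis using j(1) by blast
    qed
  qed
  have "(\<forall>g. \<exists>v\<in>reduced_mpolys N UNIV. g - v \<in> ideal.span (range F)) \<and>
    reduced_mpolys N UNIV \<inter> ideal.span (range F) = {0}"
  proof (rule triangular_reduced[OF f _ F])
    show "sp_coeff (T $ i $ i) (d i) \<noteq> 0" for i
      unfolding d_def by (rule sp_lead_coeff_nonzero[OF nz])
    show "Poly_Mapping.lookup k i < N i" if "k \<in> Poly_Mapping.keys (G i)" for i k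
      using G[OF that] p1 by (auto simp: N_def lookup_single when_def)
    show "Poly_Mapping.lookup k j = 0" if "k \<in> Poly_Mapping.keys (G i)" "f j < f i" for i j k
      using G[OF that(1)] that(2) by (auto simp: lookup_single when_def)
  qed
  then have "finite_of_rank (ideal.span (range F)) (\<Prod>i\<in>UNIV. N i)"
    by (intro finite_of_rank_reduced) auto
  moreover have "(\<Prod>i\<in>UNIV. N i) = CHAR('k) ^ (\<Sum>i\<in>UNIV. sp_degree (T $ i $ i))"
    by (simp add: N_def d_def power_sum)
  ultimately show ?thesis by (simp add: kernel_ideal_def F_def)
qed

theorem corollary2p1:
  fixes \<phi> :: "'k::field_prime_char skew_poly ^ 'n ^ 'n"
    and ddet :: "'k skew_poly lfrac ^ 'n ^ 'n \<Rightarrow> 'k skew_poly lfrac ab"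
  assumes "dieudonne_determinant ddet"
    and "ab_deg (ddet (map_matrix to_lfrac \<phi>)) < Pinf"
  shows "closed_subgroup_scheme (kernel_ideal \<phi>) \<and>
    (\<forall>\<eta> :: 'k \<Rightarrow> 'a::comm_ring_1. algebra_structure \<eta> \<longrightarrow>
       points \<eta> (kernel_ideal \<phi>) = {x. \<forall>i. Ga_endo \<eta> \<phi> x i = 0}) \<and>
    (\<exists>d. ab_deg (ddet (map_matrix to_lfrac \<phi>)) = Fin (int d) \<and>
       finite_of_rank (kernel_ideal \<phi>) (CHAR('k) ^ d))"
proof -
  \<comment> \<open>Any injection into the naturals serves as the order of the variables, since the
    index type has none.\<close>
  obtain f :: "'n \<Rightarrow> nat" where f: "inj f"
    using finite_imp_inj_to_nat_seg[OF finite_class.finite_UNIV] by blast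
  obtain T where T: "row_equiv UNIV \<phi> T" "\<And>i j. f j < f i \<Longrightarrow> T $ i $ j = 0" "\<And>i. T $ i $ i \<noteq> 0"
    "ab_deg (ddet (map_matrix to_lfrac \<phi>)) = Fin (int (\<Sum>i\<in>UNIV. sp_degree (T $ i $ i)))"
    using triangular_form[OF assms f] by blast
  have "finite_of_rank (kernel_ideal \<phi>) (CHAR('k) ^ (\<Sum>i\<in>UNIV. sp_degree (T $ i $ i)))"
    using finite_of_rank_triangular[OF f T(2,3)] kernel_ideal_row_equiv[OF T(1)] by simp
  with T(4) show ?thesis
    using closed_subgroup_scheme_kernel_ideal points_kernel_ideal by blast
qed

end
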